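(* Let $\lambda\in G$, where $G$ is the symmetrized bidisc. For a generic complex direction $\mathbb{C}v$, the solution of the Carathéodory problem $\mathrm{Car}(\lambda,v)$ is essentially unique. That is, there exists a dense open subset $V_\lambda$ of the projective space of one-dimensional complex subspaces of $\mathbb{C}^2$ such that, for every nonzero $v\in\mathbb{C}^2$ with $\mathbb{C}v\in V_\lambda$ and every pair of functions $F_1,F_2$ that solve $\mathrm{Car}(\lambda,v)$, there exists an automorphism $m$ of $\mathbb{D}$ such that $F_2=m\circ F_1$.
   Context: $\mathbb{D}$ is the open unit disc in $\mathbb{C}$. The symmetrized bidisc is the domain $G=\{(z+w,zw): |z|<1,\ |w|<1\}\subset\mathbb{C}^2$, with coordinates $(s^1,s^2)$ (superscripts are indices). A tangent to $G$ is a pair $\delta=(\lambda,v)$ with $\lambda\in G$ and $v\in\mathbb{C}^2$. $\mathbb{D}(G)$ is the set of holomorphic maps from $G$ to $\mathbb{D}$. For $F\in\mathbb{D}(G)$, $D_vF(\lambda)$ is the complex directional derivative $v_1\,\partial F/\partial s^1(\lambda)+v_2\,\partial F/\partial s^2(\lambda)$. Define $$|\delta|_{\rm car}=\sup_{F\in\mathbb{D}(G)}\frac{|D_vF(\lambda)|}{1-|F(\lambda)|^2}.$$ A function $F\in\mathbb{D}(G)$ is said to solve the Carathéodory extremal problem $\mathrm{Car}\,\delta$ if this supremum is attained at $F$. The solution of $\mathrm{Car}\,\delta$ is called essentially unique if for every pair of solutions $F_1,F_2$ there is an automorphism $m$ of $\mathbb{D}$ with $F_2=m\circ F_1$. An automorphism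 of $\mathbb{D}$ is a biholomorphic self-map of $\mathbb{D}$. *)

theory Defs
  imports "HOL-Analysis.Analysis"
begin

definition symm_bidisc :: "(complex^2) set" where
  "symm_bidisc = {vector [z + w, z * w] | z w. cmod z < 1 \<and> cmod w < 1}"

text \<open>Holomorphy in several variables: the real Frechet derivative exists at every point
  and is complex linear. Only used for open \<open>S\<close>.\<close>

definition holomorphic_vec_on :: "(complex^'n \<Rightarrow> complex) \<Rightarrow> (complex^'n) set \<Rightarrow> bool" where
  "holomorphic_vec_on F S \<longleftrightarrow>
     (\<forall>x\<in>S. \<exists>F'. (F has_derivative F') (at x) \<and> Vector_Spaces.linear (*s) (*) F')"

text \<open>Holomorphic maps from the symmetrized bidisc to the open unit disc. HOL functions are
  total; values outside \<^const>\<open>symm_bidisc\<close> are irrelevant throughout.\<close>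

definition disc_maps :: "(complex^2 \<Rightarrow> complex) set" where
  "disc_maps = {F. holomorphic_vec_on F symm_bidisc \<and> F ` symm_bidisc \<subseteq> ball 0 1}"

definition dir_deriv :: "complex^2 \<Rightarrow> (complex^2 \<Rightarrow> complex) \<Rightarrow> complex^2 \<Rightarrow> complex" where
  "dir_deriv v F l =
     v $ 1 * deriv (\<lambda>z. F (vector [z, l $ 2])) (l $ 1) +
     v $ 2 * deriv (\<lambda>z. F (vector [l $ 1, z])) (l $ 2)"

definition car_quotient :: "complex^2 \<Rightarrow> complex^2 \<Rightarrow> (complex^2 \<Rightarrow> complex) \<Rightarrow> real" where
  "car_quotient l v F = cmod (dir_deriv v F l) / (1 - (cmod (F l))\<^sup>2)"

text \<open>The supremum is taken in the extended reals, so that it is meaningful without a prior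
  proof of boundedness.\<close>

definition car_norm :: "complex^2 \<Rightarrow> complex^2 \<Rightarrow> ereal" where
  "car_norm l v = (SUP F\<in>disc_maps. ereal (car_quotient l v F))"

definition solves_car :: "complex^2 \<Rightarrow> complex^2 \<Rightarrow> (complex^2 \<Rightarrow> complex) \<Rightarrow> bool" where
  "solves_car l v F \<longleftrightarrow> F \<in> disc_maps \<and> ereal (car_quotient l v F) = car_norm l v"

definition disc_automorphism :: "(complex \<Rightarrow> complex) \<Rightarrow> bool" where
  "disc_automorphism m \<longleftrightarrow>
     m holomorphic_on ball 0 1 \<and> bij_betw m (ball 0 1) (ball 0 1) \<and>
     inv_into (ball 0 1) m holomorphic_on ball 0 1"

definition complex_lines :: "(complex^'n) set set" where
  "complex_lines = {L. vec.subspace L \<and> vec.dim L = 1}"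

text \<open>Projective space with the quotient topology induced by \<open>v \<mapsto> \<complex>v\<close> on nonzero vectors;
  see \<open>quotient_map_proj_space\<close> below.\<close>

definition proj_space :: "(complex^'n) set topology" where
  "proj_space = topology (\<lambda>U. U \<subseteq> complex_lines \<and> open {v. v \<noteq> 0 \<and> vec.span {v} \<in> U})"

lemma complex_lines_eq: "complex_lines = (\<lambda>v. vec.span {v}) ` (UNIV - {0 :: complex^'n})"
proof (intro equalityI subsetI)
  fix L :: "(complex^'n) set" assume "L \<in> complex_lines"
  then have L: "vec.subspace L" "vec.dim L = 1" by (auto simp: complex_lines_def)
  obtain B where B: "B \<subseteq> L" "vec.independent B" "L \<subseteq> vec.span B" "card B = vec.dim L"
    using vec.basis_exists by blast
  with L obtain v where v: "B = {v}" by (metis card_1_singletonE)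
  have "L = vec.span {v}" using B L v by (metis subset_antisym vec.span_minimal)
  moreover have "v \<noteq> 0" using B(2) v by auto
  ultimately show "L \<in> (\<lambda>v. vec.span {v}) ` (UNIV - {0})" by blast
next
  fix L :: "(complex^'n) set" assume "L \<in> (\<lambda>v. vec.span {v}) ` (UNIV - {0})"
  then obtain v where v: "v \<noteq> 0" "L = vec.span {v}" by blast
  have "vec.independent {v}" using v by (simp add: vec.dependent_single)
  then have "vec.dim L = 1" using v by (simp add: vec.dim_span_eq_card_independent)
  then show "L \<in> complex_lines" using v by (simp add: complex_lines_def)
qed

lemma openin_proj_space:
  "openin proj_space U \<longleftrightarrow>
     U \<subseteq> complex_lines \<and> open {v :: complex^'n. v \<noteq> 0 \<and> vec.span {v} \<in> U}"
proof -
  have "istopology (\<lambda>U. U \<subseteq> complex_lines \<and> open {v :: complex^'n. v \<noteq> 0 \<and> vec.span {v} \<in> U})"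
    unfolding istopology_def
  proof (intro conjI allI impI)
    fix S T :: "(complex^'n) set set"
    assume S: "S \<subseteq> complex_lines \<and> open {v. v \<noteq> 0 \<and> vec.span {v} \<in> S}"
      and T: "T \<subseteq> complex_lines \<and> open {v. v \<noteq> 0 \<and> vec.span {v} \<in> T}"
    then show "S \<inter> T \<subseteq> complex_lines" by blast
    have "{v. v \<noteq> 0 \<and> vec.span {v} \<in> S \<inter> T} =
        {v. v \<noteq> 0 \<and> vec.span {v} \<in> S} \<inter> {v. v \<noteq> 0 \<and> vec.span {v} \<in> T}" by blast
    then show "open {v. v \<noteq> 0 \<and> vec.span {v} \<in> S \<inter> T}" using S T by (simp only: open_Int)
  next
    fix K :: "(complex^'n) set set set"
    assume K: "\<forall>S\<in>K. S \<subseteq> complex_lines \<and> open {v. v \<noteq> 0 \<and> vec.span {v} \<in> S}"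
    then show "\<Union>K \<subseteq> complex_lines" by blast
    have "{v. v \<noteq> 0 \<and> vec.span {v} \<in> \<Union>K} = (\<Union>S\<in>K. {v. v \<noteq> 0 \<and> vec.span {v} \<in> S})" by blast
    then show "open {v. v \<noteq> 0 \<and> vec.span {v} \<in> \<Union>K}" using K by (metis (no_types, lifting) open_UN)
  qed
  then show ?thesis by (simp add: proj_space_def topology_inverse')
qed

lemma topspace_proj_space: "topspace proj_space = (complex_lines :: (complex^'n) set set)"
proof -
  have "{v :: complex^'n. v \<noteq> 0 \<and> vec.span {v} \<in> complex_lines} = - {0}"
    by (auto simp: complex_lines_eq)
  then have "openin proj_space (complex_lines :: (complex^'n) set set)"
    by (simp add: openin_proj_space open_Compl)
  then show ?thesis
    by (metis openin_proj_space openin_subset openin_topspace subset_antisym)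
qed

lemma quotient_map_proj_space:
  "quotient_map (top_of_set (UNIV - {0 :: complex^'n})) proj_space (\<lambda>v. vec.span {v})"
proof -
  have "openin (top_of_set (UNIV - {0})) {v. v \<noteq> 0 \<and> vec.span {v} \<in> U} \<longleftrightarrow>
      open {v :: complex^'n. v \<noteq> 0 \<and> vec.span {v} \<in> U}" for U
    by (subst openin_open_eq) (auto simp: open_delete)
  then show ?thesis
    unfolding quotient_map_def topspace_proj_space openin_proj_space
    by (simp add: complex_lines_eq)
qed

lemma dir_deriv_eq_derivative:
  assumes F: "(F has_derivative F') (at l)" and lin: "Vector_Spaces.linear (*s) (*) F'"
  shows "dir_deriv v F l = F' v"
proof -
  interpret F': Vector_Spaces.linear "(*s)" "(*)" F' by (fact lin)
  have vec_eq: "(vector [a, b] :: complex^2) = a *s axis 1 1 + b *s axis 2 1" for a b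
    by (simp add: vec_eq_iff forall_2 axis_def)
  have eta: "vector [l $ 1, l $ 2] = l" by (simp add: vec_eq_iff forall_2)
  have bl: "bounded_linear (\<lambda>z. z *s (u :: complex^2))" for u
    unfolding linear_conv_bounded_linear [symmetric]
    by (rule linearI) (simp_all add: vec_eq_iff algebra_simps)
  have 1: "((\<lambda>z. vector [z, l $ 2] :: complex^2) has_derivative (\<lambda>z. z *s axis 1 1)) (at (l $ 1))"
    unfolding vec_eq
    using has_derivative_add [OF bounded_linear_imp_has_derivative [OF bl] has_derivative_const] by simp
  have 2: "((\<lambda>z. vector [l $ 1, z] :: complex^2) has_derivative (\<lambda>z. z *s axis 2 1)) (at (l $ 2))"
    unfolding vec_eq
    using has_derivative_add [OF has_derivative_const bounded_linear_imp_has_derivative [OF bl]] by simp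
  have "((\<lambda>z. F (vector [z, l $ 2])) has_field_derivative F' (axis 1 1)) (at (l $ 1))"
    unfolding has_field_derivative_def
    using has_derivative_compose [OF 1, of F F'] F by (simp add: eta F'.scale mult_commute_abs)
  moreover have "((\<lambda>z. F (vector [l $ 1, z])) has_field_derivative F' (axis 2 1)) (at (l $ 2))"
    unfolding has_field_derivative_def
    using has_derivative_compose [OF 2, of F F'] F by (simp add: eta F'.scale mult_commute_abs)
  moreover have "v = v $ 1 *s axis 1 1 + v $ 2 *s axis 2 1"
    by (simp add: vec_eq_iff forall_2 axis_def)
  then have "F' v = v $ 1 * F' (axis 1 1) + v $ 2 * F' (axis 2 1)"
    by (metis F'.add F'.scale)
  ultimately show ?thesis by (simp add: dir_deriv_def DERIV_imp_deriv)
qed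

end

theory Submission
  imports Defs "HOL-Complex_Analysis.Riemann_Mapping"
begin

text \<open>For each unimodular \<open>\<omega>\<close> the function \<open>\<Phi>(s, p) = (2 * \<omega> * p - s) / (2 - \<omega> * s)\<close> maps the symmetrized bidisc
  to the disc with convex (parabolic) fibres. In half-plane coordinates \<open>\<Phi>\<close> becomes the first coordinate, and
  through a given point pass the graphs of the real pencil of functions \<open>1 + A * ((\<xi> - \<xi>0) * (\<xi> + cnj \<xi>0))\<close>,
  where \<open>A\<close> ranges over an open interval. Each graph is a disc with left inverse \<open>\<Phi>\<close>, so a direction tangent
  to one of them has \<open>\<Phi>\<close> as a solution of the Caratheodory problem. Any other solution is forced by the
  neighbouring graphs to agree with \<open>\<Phi>\<close> up to an automorphism. Moving the base point to \<open>(0, P)\<close>,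
  finding \<open>\<omega>\<close> for a given direction amounts to dropping a normal from a point to the far side of an ellipse,
  which is possible whenever the point lies off the minor axis; this holds for a dense open set of directions.\<close>

subsection \<open>Holomorphic functions on the symmetrized bidisc\<close>

lemma symm_bidisc_memI: "cmod z < 1 \<Longrightarrow> cmod w < 1 \<Longrightarrow> vector [z + w, z * w] \<in> symm_bidisc"
  by (auto simp: symm_bidisc_def)

lemma has_derivative_vector2:
  fixes f g :: "complex \<Rightarrow> complex"
  assumes f: "(f has_field_derivative f') (at z)" and g: "(g has_field_derivative g') (at z)"
  shows "((\<lambda>z. vector [f z, g z] :: complex^2) has_derivative (\<lambda>t. t *s vector [f', g'])) (at z)"
proof -
  have vec_eq: "(vector [a, b] :: complex^2) = a *s axis 1 1 + b *s axis 2 1" for a b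
    by (simp add: vec_eq_iff forall_2 axis_def)
  have bl: "bounded_linear (\<lambda>z. z *s (u :: complex^2))" for u
    unfolding linear_conv_bounded_linear [symmetric]
    by (rule linearI) (simp_all add: vec_eq_iff algebra_simps)
  show ?thesis
    unfolding vec_eq
    using has_derivative_add [OF bounded_linear.has_derivative [OF bl f [unfolded has_field_derivative_def]]
        bounded_linear.has_derivative [OF bl g [unfolded has_field_derivative_def]]]
    by (simp add: vec_eq_iff algebra_simps)
qed

lemma has_field_derivative_compose_vector2:
  fixes F :: "complex^2 \<Rightarrow> complex"
  assumes "(F has_derivative F') (at (vector [f z, g z]))" "Vector_Spaces.linear (*s) (*) F'"
    and "(f has_field_derivative f') (at z)" "(g has_field_derivative g') (at z)"
  shows "((\<lambda>z. F (vector [f z, g z])) has_field_derivative F' (vector [f', g'])) (at z)"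
proof -
  interpret F': Vector_Spaces.linear "(*s)" "(*)" F' by (fact assms(2))
  show ?thesis
    using has_derivative_compose [OF has_derivative_vector2 [OF assms(3,4)] assms(1)]
    by (simp add: has_field_derivative_def F'.scale mult_commute_abs)
qed

lemma disc_mapsE:
  assumes "F \<in> disc_maps" "l \<in> symm_bidisc"
  obtains F' where "(F has_derivative F') (at l)" "Vector_Spaces.linear (*s) (*) F'"
    "\<And>v. dir_deriv v F l = F' v"
  using assms dir_deriv_eq_derivative unfolding disc_maps_def holomorphic_vec_on_def
  by (smt (verit) mem_Collect_eq)

lemma disc_maps_norm: "F \<in> disc_maps \<Longrightarrow> s \<in> symm_bidisc \<Longrightarrow> cmod (F s) < 1"
  by (auto simp: disc_maps_def)

lemma disc_maps_compose_holomorphic: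
  assumes F: "F \<in> disc_maps" and S: "open S" and f: "f holomorphic_on S" and g: "g holomorphic_on S"
    and mem: "\<And>z. z \<in> S \<Longrightarrow> vector [f z, g z] \<in> symm_bidisc"
  shows "(\<lambda>z. F (vector [f z, g z])) holomorphic_on S"
proof -
  have "(\<lambda>z. F (vector [f z, g z])) field_differentiable at z" if "z \<in> S" for z
  proof -
    obtain F' where "(F has_derivative F') (at (vector [f z, g z]))" "Vector_Spaces.linear (*s) (*) F'"
      using disc_mapsE [OF F mem] \<open>z \<in> S\<close> by metis
    with has_field_derivative_compose_vector2 [of F F' f z g] holomorphic_derivI [OF f S that]
      holomorphic_derivI [OF g S that]
    show ?thesis unfolding field_differentiable_def by blast
  qed
  then show ?thesis
    by (simp add: holomorphic_on_def field_differentiable_at_within)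
qed

lemma solves_car_ge:
  assumes "solves_car l v F" "G \<in> disc_maps"
  shows "car_quotient l v G \<le> car_quotient l v F"
proof -
  have "ereal (car_quotient l v G) \<le> car_norm l v"
    unfolding car_norm_def using assms(2) by (rule SUP_upper)
  then show ?thesis using assms(1) by (simp add: solves_car_def flip: ereal_less_eq(3))
qed

lemma has_derivative_affine_quotient:
  fixes n m :: "nat \<Rightarrow> complex" and s :: "complex^2"
  assumes "m 0 + m 1 * s $ 1 + m 2 * s $ 2 \<noteq> 0"
  shows "\<exists>F'. ((\<lambda>s. (n 0 + n 1 * s $ 1 + n 2 * s $ 2) / (m 0 + m 1 * s $ 1 + m 2 * s $ 2))
      has_derivative F') (at s) \<and> Vector_Spaces.linear (*s) (*) F'"
proof (intro exI conjI)
  let ?D = "m 0 + m 1 * s $ 1 + m 2 * s $ 2" and ?N = "n 0 + n 1 * s $ 1 + n 2 * s $ 2"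
  let ?F = "\<lambda>h :: complex^2. ((n 1 * h $ 1 + n 2 * h $ 2) * ?D - ?N * (m 1 * h $ 1 + m 2 * h $ 2)) / (?D * ?D)"
  have c: "((\<lambda>s :: complex^2. s $ i) has_derivative (\<lambda>h. h $ i)) (at s)" for i
    by (intro bounded_linear_imp_has_derivative bounded_linear_vec_nth)
  have aff: "((\<lambda>s :: complex^2. k 0 + k 1 * s $ 1 + k 2 * s $ 2) has_derivative (\<lambda>h. k 1 * h $ 1 + k 2 * h $ 2)) (at s)"
    for k :: "nat \<Rightarrow> complex"
    by (auto intro!: derivative_eq_intros c)
  show "((\<lambda>s. (n 0 + n 1 * s $ 1 + n 2 * s $ 2) / (m 0 + m 1 * s $ 1 + m 2 * s $ 2)) has_derivative ?F) (at s)"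
    using has_derivative_divide' [OF aff [of n] aff [of m]] assms by (simp add: algebra_simps)
  show "Vector_Spaces.linear (*s) (*) ?F"
    by unfold_locales (simp_all add: algebra_simps add_divide_distrib diff_divide_distrib)
qed

text \<open>\<open>Moebius_function 0 w\<close> and \<open>Moebius_function 0 (- w)\<close> are
  mutually inverse on the disc, so the inverse has the same shape with \<open>w1\<close>,
  \<open>w2\<close> exchanged and \<open>e\<close> inverted.\<close>

lemma disc_automorphismI:
  assumes "cmod w1 < 1" "cmod w2 < 1" "cmod e = 1"
  shows "disc_automorphism (\<lambda>z. Moebius_function 0 (- w2) (e * Moebius_function 0 w1 z))"
proof -
  let ?B = "ball (0::complex) 1"
  let ?m = "\<lambda>z. Moebius_function 0 (- w2) (e * Moebius_function 0 w1 z)"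
  let ?n = "\<lambda>z. Moebius_function 0 (- w1) (inverse e * Moebius_function 0 w2 z)"
  have e: "e \<noteq> 0" "cmod (inverse e) = 1" using assms(3) by (auto simp: norm_inverse)
  have hol: "(\<lambda>z. Moebius_function 0 (- w) (k * Moebius_function 0 w' z)) holomorphic_on ?B"
    and maps: "\<And>z. z \<in> ?B \<Longrightarrow> Moebius_function 0 (- w) (k * Moebius_function 0 w' z) \<in> ?B"
    if "cmod w < 1" "cmod w' < 1" "cmod k = 1" for w w' k
  proof -
    have i: "k * Moebius_function 0 w' z \<in> ?B" if "z \<in> ?B" for z
      using that \<open>cmod w' < 1\<close> \<open>cmod k = 1\<close> by (simp add: norm_mult Moebius_function_norm_lt_1)
    show "\<And>z. z \<in> ?B \<Longrightarrow> Moebius_function 0 (- w) (k * Moebius_function 0 w' z) \<in> ?B"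
      using i \<open>cmod w < 1\<close> by (simp add: Moebius_function_norm_lt_1)
    have "(\<lambda>z. k * Moebius_function 0 w' z) holomorphic_on ?B"
      by (intro holomorphic_intros Moebius_function_holomorphic that)
    moreover have "Moebius_function 0 (- w) holomorphic_on ?B"
      using that by (intro Moebius_function_holomorphic) simp
    ultimately show "(\<lambda>z. Moebius_function 0 (- w) (k * Moebius_function 0 w' z)) holomorphic_on ?B"
      by (rule holomorphic_on_compose_gen [unfolded o_def]) (use i in blast)
  qed
  have nm: "?n (?m z) = z" if "z \<in> ?B" for z
  proof -
    have "cmod (e * Moebius_function 0 w1 z) < 1"
      using that assms by (simp add: norm_mult Moebius_function_norm_lt_1)
    then show ?thesis using that assms e by (simp add: Moebius_function_compose flip: mult.assoc)
  qed
  have mn: "?m (?n z) = z" if "z \<in> ?B" for z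
  proof -
    have "cmod (inverse e * Moebius_function 0 w2 z) < 1"
      using that assms e by (simp add: norm_mult Moebius_function_norm_lt_1)
    then show ?thesis using that assms e by (simp add: Moebius_function_compose flip: mult.assoc)
  qed
  have bij: "bij_betw ?m ?B ?B"
    by (rule bij_betw_byWitness [where f' = ?n]) (use nm mn maps assms e in auto)
  have "inv_into ?B ?m z = ?n z" if "z \<in> ?B" for z
    by (metis (no_types, lifting) bij bij_betw_imp_inj_on inv_into_f_eq maps[OF assms(1,2) e(2)] mn that)
  then have "inv_into ?B ?m holomorphic_on ?B"
    using hol [OF assms(1,2) e(2)] by (metis (no_types, lifting) holomorphic_transform)
  then show ?thesis
    using hol [OF assms(2,1,3)] bij by (simp add: disc_automorphism_def)
qed

text \<open>For \<open>z = x + \<i> * y\<close> the terms are \<open>x\<^sup>2 + y\<^sup>2\<close>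
  and \<open>x\<^sup>2 - y\<^sup>2\<close>. A bound on the real part of a square root thus becomes a
  condition on the square, which is how the fibres are described.\<close>

lemma norm_plus_Re_square: "cmod (z\<^sup>2) + Re (z\<^sup>2) = 2 * (Re z)\<^sup>2"
  by (simp only: norm_power cmod_power2) (simp add: power2_eq_square)

subsection \<open>A pencil of discs\<close>

text \<open>The parallelogram law: a unimodular number is an extreme point of the closed unit
  disc.\<close>

lemma eq_0_if_norm_add_diff_le:
  fixes u y :: complex
  assumes "cmod u = 1" "cmod (u + y) \<le> 1" "cmod (u - y) \<le> 1"
  shows "y = 0"
proof -
  have "(cmod (u + y))\<^sup>2 + (cmod (u - y))\<^sup>2 = 2 * (cmod u)\<^sup>2 + 2 * (cmod y)\<^sup>2"
    unfolding cmod_power2 by (simp add: power2_eq_square algebra_simps)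
  moreover have "(cmod (u + y))\<^sup>2 \<le> 1" "(cmod (u - y))\<^sup>2 \<le> 1"
    using assms by (simp_all add: power_le_one)
  moreover have "(cmod u)\<^sup>2 = 1" using assms(1) by simp
  ultimately have "(cmod y)\<^sup>2 \<le> 0" by linarith
  then show ?thesis by simp
qed

lemma Moebius_function_has_derivative_center:
  assumes "cmod w < 1"
  shows "(Moebius_function 0 w has_field_derivative 1 / of_real (1 - (cmod w)\<^sup>2)) (at w)"
proof -
  have e: "1 - cnj w * w = of_real (1 - (cmod w)\<^sup>2)"
    by (simp add: complex_norm_square mult.commute del: of_real_power)
  have "(cmod w)\<^sup>2 < 1" using assms by (simp add: power_less_one_iff abs_square_less_1)
  then have nz: "1 - cnj w * w \<noteq> 0" unfolding e by (metis less_irrefl of_real_eq_0_iff right_minus_eq)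
  have "((\<lambda>z. (z - w) / (1 - cnj w * z)) has_field_derivative 1 / (1 - cnj w * w)) (at w)"
    using nz by (auto intro!: derivative_eq_intros)
  then show ?thesis unfolding e Moebius_function_simple [abs_def] by simp
qed

text \<open>The disc \<open>\<xi> \<mapsto> (\<xi>, geodesic \<xi>0 A \<xi>)\<close> stays in the fibres because, for admissible \<open>A\<close>,
  \<open>\<xi>\<^sup>2 - geodesic \<xi>0 A \<xi> = (1 - A) * (\<xi> + \<i> * B)\<^sup>2 - m\<close> with real \<open>B\<close> and \<open>m > 0\<close>.\<close>

definition admissible :: "complex \<Rightarrow> real \<Rightarrow> bool" where
  "admissible \<xi>0 A \<longleftrightarrow> 0 < A \<and> A < 1 \<and> (A * Im \<xi>0)\<^sup>2 < (1 - A) * (1 - A * (cmod \<xi>0)\<^sup>2)"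

lemma open_admissible: "open {A. admissible \<xi>0 A}"
  unfolding admissible_def by (intro open_Collect_conj open_Collect_less continuous_intros)

text \<open>The slope at \<open>\<xi>0\<close> is
  \<open>A * (\<xi>0 + cnj \<xi>0) = 2 * A * Re \<xi>0\<close>, the value later handed to
  \<open>tangent\<close>. Over any other point of the right half-plane the values for varying
  \<open>A\<close> run along a real line.\<close>

definition geodesic :: "complex \<Rightarrow> real \<Rightarrow> complex \<Rightarrow> complex" where
  "geodesic \<xi>0 A \<xi> = 1 + A * ((\<xi> - \<xi>0) * (\<xi> + cnj \<xi>0))"

lemma geodesic_base [simp]: "geodesic \<xi>0 A \<xi>0 = 1"
  by (simp add: geodesic_def)

text \<open>For \<open>Re \<xi>0 > 0\<close> the conformal map of the unit disc onto the right
  half-plane with \<open>0 \<mapsto> \<xi>0\<close>. It parametrises the pencil by the disc, where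
  the Schwarz lemma applies.\<close>

definition cayley :: "complex \<Rightarrow> complex \<Rightarrow> complex" where
  "cayley \<xi>0 z = (\<xi>0 + cnj \<xi>0 * z) / (1 - z)"

lemma cayley_0 [simp]: "cayley \<xi>0 0 = \<xi>0"
  by (simp add: cayley_def)

lemma Re_cayley:
  assumes "Re \<xi>0 > 0" "cmod z < 1"
  shows "Re (cayley \<xi>0 z) > 0"
proof -
  have nz: "1 - z \<noteq> 0" using assms by auto
  have "(cmod z)\<^sup>2 < 1" using assms by (simp add: power_less_one_iff abs_square_less_1)
  then have "Re \<xi>0 * (1 - (cmod z)\<^sup>2) > 0" using assms by simp
  also have "Re \<xi>0 * (1 - (cmod z)\<^sup>2) = Re ((\<xi>0 + cnj \<xi>0 * z) * cnj (1 - z))"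
    unfolding cmod_power2 by (simp add: power2_eq_square algebra_simps)
  finally show ?thesis
    using nz by (simp add: cayley_def Re_complex_div_gt_0)
qed

lemma cayley_inverse:
  assumes "Re \<xi>0 > 0" "Re \<xi> > 0"
  shows "cayley \<xi>0 ((\<xi> - \<xi>0) / (\<xi> + cnj \<xi>0)) = \<xi>" "cmod ((\<xi> - \<xi>0) / (\<xi> + cnj \<xi>0)) < 1"
proof -
  have "Re (\<xi> + cnj \<xi>0) \<noteq> 0" "Re (\<xi>0 + cnj \<xi>0) \<noteq> 0" using assms by simp_all
  then have nz: "\<xi> + cnj \<xi>0 \<noteq> 0" "\<xi>0 + cnj \<xi>0 \<noteq> 0" by (metis zero_complex.sel(1))+
  have "1 - (\<xi> - \<xi>0) / (\<xi> + cnj \<xi>0) = (\<xi>0 + cnj \<xi>0) / (\<xi> + cnj \<xi>0)"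
    "\<xi>0 + cnj \<xi>0 * ((\<xi> - \<xi>0) / (\<xi> + cnj \<xi>0)) = \<xi> * (\<xi>0 + cnj \<xi>0) / (\<xi> + cnj \<xi>0)"
    using nz by (simp_all add: field_simps)
  then show "cayley \<xi>0 ((\<xi> - \<xi>0) / (\<xi> + cnj \<xi>0)) = \<xi>" using nz by (simp add: cayley_def)
  \<comment> \<open>The difference of the two squares is
    \<open>4 * Re \<xi> * Re \<xi>0\<close>.\<close>
  have "(cmod (\<xi> - \<xi>0))\<^sup>2 < (cmod (\<xi> + cnj \<xi>0))\<^sup>2"
    using mult_pos_pos [OF assms] unfolding cmod_power2 by (simp add: power2_eq_square algebra_simps)
  then have "cmod (\<xi> - \<xi>0) < cmod (\<xi> + cnj \<xi>0)" by (rule power_less_imp_less_base) simp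
  then show "cmod ((\<xi> - \<xi>0) / (\<xi> + cnj \<xi>0)) < 1" using nz by (simp add: norm_divide)
qed

lemma cayley_coord:
  assumes "Re \<xi>0 > 0" "cmod z < 1"
  shows "(cayley \<xi>0 z - \<xi>0) / (cayley \<xi>0 z + cnj \<xi>0) = z"
proof -
  have nz: "1 - z \<noteq> 0" using assms by auto
  have "Re (\<xi>0 + cnj \<xi>0) \<noteq> 0" using assms by simp
  then have nz': "\<xi>0 + cnj \<xi>0 \<noteq> 0" by (metis zero_complex.sel(1))
  have "cayley \<xi>0 z - \<xi>0 = (\<xi>0 + cnj \<xi>0) * z / (1 - z)" "cayley \<xi>0 z + cnj \<xi>0 = (\<xi>0 + cnj \<xi>0) / (1 - z)"
    using nz by (simp_all add: cayley_def field_simps)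
  then show ?thesis using nz nz' by simp
qed

lemma cayley_has_derivative: "(cayley \<xi>0 has_field_derivative \<xi>0 + cnj \<xi>0) (at 0)"
  unfolding cayley_def [abs_def] by (auto intro!: derivative_eq_intros)

lemma cayley_holomorphic: "cayley \<xi>0 holomorphic_on ball 0 1"
  unfolding cayley_def [abs_def] by (intro holomorphic_intros) auto

subsection \<open>Half-plane charts\<close>

text \<open>The Moebius map \<open>y \<mapsto> (a * y + b) / (c * y + d)\<close> takes the right
  half-plane onto the unit disc. A strict inequality in place of a quotient also excludes zeros of
  the denominator.\<close>

locale half_plane_chart =
  fixes a b c d :: complex
  assumes norm_less: "Re y > 0 \<Longrightarrow> cmod (a * y + b) < cmod (c * y + d)"
    and inverse_mem: "cmod x < 1 \<Longrightarrow> a - c * x \<noteq> 0 \<and> Re ((d * x - b) / (a - c * x)) > 0"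
    and det: "a * d - b * c \<noteq> 0"
begin

definition den :: "complex \<Rightarrow> complex \<Rightarrow> complex" where
  "den \<xi> p = c\<^sup>2 * p + 2 * c * d * \<xi> + d\<^sup>2"

text \<open>If \<open>x1\<close>, \<open>x2\<close> are the images of \<open>y1\<close>, \<open>y2\<close> in the right half-plane under
  \<open>y \<mapsto> (a * y + b) / (c * y + d)\<close>, then \<open>chart\<close> sends \<open>((y1 + y2) / 2, y1 * y2)\<close> to \<open>(x1 + x2, x1 * x2)\<close>.
  It is projective linear. The fibre over \<open>\<xi>\<close> is a parabola, hence convex.\<close>

definition chart :: "complex \<Rightarrow> complex \<Rightarrow> complex^2" where
  "chart \<xi> p = vector [(2 * a * c * p + 2 * (a * d + b * c) * \<xi> + 2 * b * d) / den \<xi> p,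
     (a\<^sup>2 * p + 2 * a * b * \<xi> + b\<^sup>2) / den \<xi> p]"

definition fibre :: "complex \<Rightarrow> complex set" where
  "fibre \<xi> = {p. cmod (\<xi>\<^sup>2 - p) + Re (\<xi>\<^sup>2 - p) < 2 * (Re \<xi>)\<^sup>2}"

lemma denominator_nonzero: "Re y > 0 \<Longrightarrow> c * y + d \<noteq> 0"
  using norm_less by force

lemma den_roots: "den ((y1 + y2) / 2) (y1 * y2) = (c * y1 + d) * (c * y2 + d)"
  by (simp add: den_def power2_eq_square algebra_simps)

lemma chart_roots:
  assumes "Re y1 > 0" "Re y2 > 0"
  shows "chart ((y1 + y2) / 2) (y1 * y2) =
    vector [(a * y1 + b) / (c * y1 + d) + (a * y2 + b) / (c * y2 + d),
      (a * y1 + b) / (c * y1 + d) * ((a * y2 + b) / (c * y2 + d))]"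
  using assms denominator_nonzero [of y1] denominator_nonzero [of y2]
  by (simp add: chart_def den_roots vec_eq_iff forall_2 divide_simps)
    (simp add: power2_eq_square algebra_simps)

text \<open>The roots of \<open>y\<^sup>2 - 2 * \<xi> * y + p\<close> are \<open>\<xi> + r\<close>
  and \<open>\<xi> - r\<close> with \<open>r\<^sup>2 = \<xi>\<^sup>2 - p\<close>. By
  \<open>norm_plus_Re_square\<close> the inequality in \<open>fibre\<close> says
  \<open>\<bar>Re r\<bar> < Re \<xi>\<close>.\<close>

lemma fibre_roots:
  assumes "Re \<xi> > 0" "p \<in> fibre \<xi>"
  obtains y1 y2 where "Re y1 > 0" "Re y2 > 0" "\<xi> = (y1 + y2) / 2" "p = y1 * y2"
proof -
  define r where "r = csqrt (\<xi>\<^sup>2 - p)"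
  have r: "r\<^sup>2 = \<xi>\<^sup>2 - p" by (simp add: r_def)
  have "(Re r)\<^sup>2 < (Re \<xi>)\<^sup>2"
    using assms(2) norm_plus_Re_square [of r] by (simp add: fibre_def r)
  then have "\<bar>Re r\<bar> < Re \<xi>"
    using assms(1) by (metis abs_of_pos abs_le_square_iff linorder_not_less)
  moreover have "p = (\<xi> + r) * (\<xi> - r)"
    using r by (simp add: power2_eq_square algebra_simps)
  ultimately show ?thesis
    using that [of "\<xi> + r" "\<xi> - r"] by simp
qed

lemma roots_in_fibre:
  assumes "Re y1 > 0" "Re y2 > 0"
  shows "y1 * y2 \<in> fibre ((y1 + y2) / 2)"
proof -
  have e: "((y1 + y2) / 2)\<^sup>2 - y1 * y2 = ((y1 - y2) / 2)\<^sup>2"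
    by (simp add: power2_eq_square field_simps)
  have "(Re y1 - Re y2)\<^sup>2 < (Re y1 + Re y2)\<^sup>2"
    using mult_pos_pos [OF assms] by (simp add: power2_eq_square algebra_simps)
  then show ?thesis
    unfolding fibre_def mem_Collect_eq e norm_plus_Re_square by (simp add: power_divide)
qed

lemma chart_mem:
  assumes "Re \<xi> > 0" "p \<in> fibre \<xi>"
  shows "chart \<xi> p \<in> symm_bidisc" "den \<xi> p \<noteq> 0"
proof -
  obtain y1 y2 where y: "Re y1 > 0" "Re y2 > 0" "\<xi> = (y1 + y2) / 2" "p = y1 * y2"
    using fibre_roots [OF assms] .
  have "cmod ((a * y + b) / (c * y + d)) < 1" if "Re y > 0" for y
    using norm_less [OF that] denominator_nonzero [OF that] by (simp add: norm_divide)
  then show "chart \<xi> p \<in> symm_bidisc"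
    unfolding y chart_roots [OF y(1,2)] using y(1,2) by (intro symm_bidisc_memI) auto
  show "den \<xi> p \<noteq> 0"
    unfolding y den_roots using denominator_nonzero y(1,2) by auto
qed

lemma chart_surj:
  assumes "s \<in> symm_bidisc"
  obtains \<xi> p where "Re \<xi> > 0" "p \<in> fibre \<xi>" "s = chart \<xi> p"
proof -
  obtain x1 x2 where x: "cmod x1 < 1" "cmod x2 < 1" "s = vector [x1 + x2, x1 * x2]"
    using assms by (auto simp: symm_bidisc_def)
  define y where "y x = (d * x - b) / (a - c * x)" for x
  have *: "(a * y x + b) / (c * y x + d) = x" "Re (y x) > 0" if "cmod x < 1" for x
  proof -
    have nz: "a - c * x \<noteq> 0" using inverse_mem [OF that] by blast
    have "a * y x + b = (a * d - b * c) * x / (a - c * x)" "c * y x + d = (a * d - b * c) / (a - c * x)"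
      using nz by (simp_all add: y_def field_simps)
    then show "(a * y x + b) / (c * y x + d) = x" using nz det by simp
    show "Re (y x) > 0" using inverse_mem [OF that] by (simp add: y_def)
  qed
  note pos = *(2) [OF x(1)] *(2) [OF x(2)]
  show ?thesis
  proof (rule that [of "(y x1 + y x2) / 2" "y x1 * y x2"])
    show "Re ((y x1 + y x2) / 2) > 0" using pos by simp
    show "y x1 * y x2 \<in> fibre ((y x1 + y x2) / 2)" using pos by (rule roots_in_fibre)
    show "s = chart ((y x1 + y x2) / 2) (y x1 * y x2)"
      unfolding chart_roots [OF pos] x(3) * (1) [OF x(1)] * (1) [OF x(2)] ..
  qed
qed

lemma open_fibre: "open (fibre \<xi>)"
  unfolding fibre_def by (intro open_Collect_less continuous_intros)

text \<open>The function \<open>cmod z + Re z\<close> is convex, and the fibre is a sublevel set of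
  it composed with an affine map. Convexity supplies the connectedness for the identity
  theorem.\<close>

lemma convex_fibre: "convex (fibre \<xi>)"
proof (rule convexI)
  fix p q :: complex and u v :: real
  assume pq: "p \<in> fibre \<xi>" "q \<in> fibre \<xi>" and uv: "0 \<le> u" "0 \<le> v" "u + v = 1"
  define P Q where "P = \<xi>\<^sup>2 - p" and "Q = \<xi>\<^sup>2 - q"
  have "\<xi>\<^sup>2 = u *\<^sub>R \<xi>\<^sup>2 + v *\<^sub>R \<xi>\<^sup>2" using uv by (metis scaleR_add_left scaleR_one)
  then have e: "\<xi>\<^sup>2 - (u *\<^sub>R p + v *\<^sub>R q) = u *\<^sub>R P + v *\<^sub>R Q"
    by (simp add: P_def Q_def scaleR_diff_right)
  have "cmod (u *\<^sub>R P + v *\<^sub>R Q) \<le> u * cmod P + v * cmod Q"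
    using norm_triangle_ineq [of "u *\<^sub>R P" "v *\<^sub>R Q"] uv by simp
  then have "cmod (u *\<^sub>R P + v *\<^sub>R Q) + Re (u *\<^sub>R P + v *\<^sub>R Q)
    \<le> u * (cmod P + Re P) + v * (cmod Q + Re Q)"
    by (simp add: algebra_simps)
  also have "\<dots> < 2 * (Re \<xi>)\<^sup>2"
    using pq uv convex_bound_lt [of "cmod P + Re P" "2 * (Re \<xi>)\<^sup>2" "cmod Q + Re Q" u v]
    by (simp add: fibre_def P_def Q_def)
  finally show "u *\<^sub>R p + v *\<^sub>R q \<in> fibre \<xi>" unfolding fibre_def mem_Collect_eq e .
qed

section \<open>The extremal function on the symmetrized bidisc\<close>

text \<open>The first chart coordinate as a fractional linear function of \<open>s\<close>, followed
  by the inverse of \<open>cayley \<xi>0\<close>. Numerator and denominator are one expression in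
  \<open>k\<close>, taken at \<open>k = - \<xi>0\<close> and \<open>k = cnj \<xi>0\<close>.\<close>

definition coord :: "complex \<Rightarrow> complex^2 \<Rightarrow> complex" where
  "coord \<xi>0 s =
    (- a * b - \<xi>0 * a\<^sup>2 + ((a * d + b * c) / 2 + \<xi>0 * a * c) * s $ 1 + (- c * d - \<xi>0 * c\<^sup>2) * s $ 2) /
    (- a * b + cnj \<xi>0 * a\<^sup>2 + ((a * d + b * c) / 2 - cnj \<xi>0 * a * c) * s $ 1 + (- c * d + cnj \<xi>0 * c\<^sup>2) * s $ 2)"

lemma coord_chart:
  assumes "Re \<xi>0 > 0" "Re \<xi> > 0" "p \<in> fibre \<xi>"
  shows "coord \<xi>0 (chart \<xi> p) = (\<xi> - \<xi>0) / (\<xi> + cnj \<xi>0)"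
    "- a * b + cnj \<xi>0 * a\<^sup>2 + ((a * d + b * c) / 2 - cnj \<xi>0 * a * c) * chart \<xi> p $ 1 + (- c * d + cnj \<xi>0 * c\<^sup>2) * chart \<xi> p $ 2 \<noteq> 0"
proof -
  have nz: "den \<xi> p \<noteq> 0" using chart_mem assms by blast
  have *: "- a * b + k * a\<^sup>2 + ((a * d + b * c) / 2 - k * a * c) * chart \<xi> p $ 1 + (- c * d + k * c\<^sup>2) * chart \<xi> p $ 2
    = (a * d - b * c)\<^sup>2 * (\<xi> + k) / den \<xi> p" for k
    using nz by (simp add: chart_def field_simps)
     (simp add: den_def power2_eq_square algebra_simps)
  have "Re (\<xi> + cnj \<xi>0) \<noteq> 0" using assms by simp
  then have nz2: "\<xi> + cnj \<xi>0 \<noteq> 0" by (metis zero_complex.sel(1))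
  show "- a * b + cnj \<xi>0 * a\<^sup>2 + ((a * d + b * c) / 2 - cnj \<xi>0 * a * c) * chart \<xi> p $ 1 + (- c * d + cnj \<xi>0 * c\<^sup>2) * chart \<xi> p $ 2 \<noteq> 0"
    unfolding * using nz nz2 det by simp
  have "coord \<xi>0 (chart \<xi> p) = ((a * d - b * c)\<^sup>2 * (\<xi> + - \<xi>0) / den \<xi> p) / ((a * d - b * c)\<^sup>2 * (\<xi> + cnj \<xi>0) / den \<xi> p)"
    unfolding * [symmetric] coord_def by simp
  then show "coord \<xi>0 (chart \<xi> p) = (\<xi> - \<xi>0) / (\<xi> + cnj \<xi>0)"
    using nz det by simp
qed

lemma coord_disc_map:
  assumes "Re \<xi>0 > 0"
  shows "coord \<xi>0 \<in> disc_maps"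
proof -
  have "\<exists>F'. (coord \<xi>0 has_derivative F') (at s) \<and> Vector_Spaces.linear (*s) (*) F'"
    and "cmod (coord \<xi>0 s) < 1" if s: "s \<in> symm_bidisc" for s
  proof -
    obtain \<xi> p where x: "Re \<xi> > 0" "p \<in> fibre \<xi>" "s = chart \<xi> p" using chart_surj [OF s] .
    let ?k = "\<lambda>k. (\<lambda>i :: nat. if i = 0 then - a * b + k * a\<^sup>2 else if i = 1 then (a * d + b * c) / 2 - k * a * c
      else - c * d + k * c\<^sup>2)"
    show "\<exists>F'. (coord \<xi>0 has_derivative F') (at s) \<and> Vector_Spaces.linear (*s) (*) F'"
      using has_derivative_affine_quotient [of "?k (cnj \<xi>0)" s "?k (- \<xi>0)"] coord_chart(2) [OF assms x(1,2)]
      unfolding coord_def [abs_def] x(3) by simp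
    have "(cmod (\<xi> - \<xi>0))\<^sup>2 < (cmod (\<xi> + cnj \<xi>0))\<^sup>2"
      using mult_pos_pos [OF assms x(1)] unfolding cmod_power2 by (simp add: power2_eq_square algebra_simps)
    then have "cmod (\<xi> - \<xi>0) < cmod (\<xi> + cnj \<xi>0)" by (rule power_less_imp_less_base) simp
    then show "cmod (coord \<xi>0 s) < 1"
      unfolding x(3) coord_chart(1) [OF assms x(1,2)] norm_divide
      by (metis divide_less_eq_1_pos norm_ge_zero order_le_less_trans)
  qed
  then show ?thesis by (auto simp: disc_maps_def holomorphic_vec_on_def)
qed

lemma geodesic_in_fibre:
  assumes adm: "admissible \<xi>0 A" and "Re \<xi> > 0"
  shows "geodesic \<xi>0 A \<xi> \<in> fibre \<xi>"
proof -
  \<comment> \<open>\<open>B\<close> and \<open>m\<close> come from completing the square in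
    \<open>\<xi>\<^sup>2 - geodesic \<xi>0 A \<xi>\<close>; admissibility gives \<open>m\<close> its
    sign.\<close>
  define h B m where "h = Im \<xi>0" and "B = A * h / (1 - A)" and "m = (1 - A * (cmod \<xi>0)\<^sup>2) - (A * h)\<^sup>2 / (1 - A)"
  have A: "0 < A" "A < 1" "(A * h)\<^sup>2 < (1 - A) * (1 - A * (cmod \<xi>0)\<^sup>2)"
    using adm by (auto simp: admissible_def h_def)
  have m: "m \<ge> 0" using A by (simp add: m_def field_simps)
  define W where "W = (\<xi> + \<i> * B)\<^sup>2"
  have B: "(1 - A) * B = A * h" "(1 - A) * B\<^sup>2 = (A * h)\<^sup>2 / (1 - A)"
    using A by (simp_all add: B_def power2_eq_square)
  have nn: "complex_of_real ((cmod \<xi>0)\<^sup>2) = \<xi>0 * cnj \<xi>0" "\<xi>0 - cnj \<xi>0 = 2 * \<i> * h"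
    by (fact complex_norm_square) (simp add: h_def complex_eq_iff)
  have e: "\<xi>\<^sup>2 - geodesic \<xi>0 A \<xi> = of_real (1 - A) * W - of_real m"
  proof -
    have "of_real (1 - A) * W = of_real (1 - A) * \<xi>\<^sup>2 + 2 * \<i> * \<xi> * of_real ((1 - A) * B) - of_real ((1 - A) * B\<^sup>2)"
      by (simp add: W_def power2_eq_square algebra_simps)
    also have "\<dots> = of_real (1 - A) * \<xi>\<^sup>2 + A * \<xi> * (2 * \<i> * h) - of_real ((A * h)\<^sup>2 / (1 - A))"
      unfolding B by simp
    also have "\<dots> = of_real (1 - A) * \<xi>\<^sup>2 + A * \<xi> * (\<xi>0 - cnj \<xi>0) - of_real (1 - A * (cmod \<xi>0)\<^sup>2 - m)"
      unfolding nn by (simp add: m_def)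
    finally have "of_real (1 - A) * W - of_real m = of_real (1 - A) * \<xi>\<^sup>2 + A * \<xi> * (\<xi>0 - cnj \<xi>0) - 1 + A * of_real ((cmod \<xi>0)\<^sup>2)"
      by simp
    moreover have "of_real (cmod \<xi>0) * of_real (cmod \<xi>0) = \<xi>0 * cnj \<xi>0"
      using nn(1) by (simp add: power2_eq_square)
    ultimately show ?thesis
      by (simp add: geodesic_def power2_eq_square algebra_simps)
  qed
  \<comment> \<open>The constant raises the modulus by at most \<open>m\<close> and lowers the real
    part by \<open>m\<close>, so it drops out of the sum.\<close>
  have "cmod (of_real (1 - A) * W - of_real m) \<le> (1 - A) * cmod W + m"
    using norm_triangle_ineq4 [of "of_real (1 - A) * W" "of_real m"] A m
    by (simp add: norm_mult del: of_real_diff)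
  then have "cmod (of_real (1 - A) * W - of_real m) + Re (of_real (1 - A) * W - of_real m)
      \<le> (1 - A) * (cmod W + Re W)"
    by (simp add: algebra_simps)
  \<comment> \<open>Since \<open>B\<close> is real, the shift by \<open>\<i> * B\<close> leaves the
    real part of \<open>\<xi>\<close> unchanged.\<close>
  also have "\<dots> = (1 - A) * (2 * (Re \<xi>)\<^sup>2)"
    by (simp add: W_def norm_plus_Re_square)
  also have "\<dots> < 2 * (Re \<xi>)\<^sup>2" using A assms(2) by simp
  finally show ?thesis unfolding fibre_def mem_Collect_eq e .
qed

text \<open>Up to a scalar factor, \<open>tangent \<xi>0 t\<close> is the image of the direction \<open>(1, t)\<close> under the derivative
  of \<open>chart\<close> at \<open>(\<xi>0, 1)\<close>.\<close>

definition tangent :: "complex \<Rightarrow> complex \<Rightarrow> complex^2" where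
  "tangent \<xi>0 t = vector [2 * (d\<^sup>2 - c\<^sup>2 + t * c * (c * \<xi>0 + d)),
     2 * (b * d - a * c) + t * (2 * a * c * \<xi>0 + a * d + b * c)]"

text \<open>The scalar in front of \<open>F' (tangent \<xi>0 t)\<close> is independent of the slope
  \<open>t\<close>, so derivatives along different members of the pencil can be compared.\<close>

lemma chart_has_derivative:
  assumes f: "(f has_field_derivative k) (at z)" and g: "(g has_field_derivative k * t) (at z)"
    and fg: "f z = \<xi>0" "g z = 1" and nz: "den \<xi>0 1 \<noteq> 0"
    and F: "(F has_derivative F') (at (chart \<xi>0 1))" "Vector_Spaces.linear (*s) (*) F'"
  shows "((\<lambda>z. F (chart (f z) (g z))) has_field_derivative
     k * (a * d - b * c) / (den \<xi>0 1)\<^sup>2 * F' (tangent \<xi>0 t)) (at z)"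
proof -
  interpret F': Vector_Spaces.linear "(*s)" "(*)" F' by (fact F(2))
  let ?K = "k * (a * d - b * c) / (den \<xi>0 1)\<^sup>2"
  define u where "u z = (2 * a * c * g z + 2 * (a * d + b * c) * f z + 2 * b * d) / den (f z) (g z)" for z
  define v where "v z = (a\<^sup>2 * g z + 2 * a * b * f z + b\<^sup>2) / den (f z) (g z)" for z
  have chart: "chart (f z) (g z) = vector [u z, v z]" for z by (simp add: chart_def u_def v_def)
  have nz': "c\<^sup>2 * g z + 2 * c * d * f z + d\<^sup>2 \<noteq> 0" using nz by (simp add: den_def fg)
  have 1: "(u has_field_derivative ?K * tangent \<xi>0 t $ 1) (at z)"
    unfolding u_def [abs_def] den_def [of "f _"] using nz'
    apply (auto intro!: derivative_eq_intros f g)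
    unfolding fg using nz unfolding den_def
    by (simp add: field_simps tangent_def power2_eq_square)
  have 2: "(v has_field_derivative ?K * tangent \<xi>0 t $ 2) (at z)"
    unfolding v_def [abs_def] den_def [of "f _"] using nz'
    apply (auto intro!: derivative_eq_intros f g)
    unfolding fg using nz unfolding den_def
    by (simp add: field_simps tangent_def power2_eq_square)
  have "vector [?K * tangent \<xi>0 t $ 1, ?K * tangent \<xi>0 t $ 2] = ?K *s tangent \<xi>0 t"
    by (simp add: vec_eq_iff forall_2)
  moreover have "(F has_derivative F') (at (vector [u z, v z]))"
    using F(1) by (simp flip: chart add: fg)
  ultimately show ?thesis
    unfolding chart using has_field_derivative_compose_vector2 [OF _ F(2) 1 2] by (simp add: F'.scale)
qed

lemma tangent_affine:
  assumes "Vector_Spaces.linear (*s) (*) F'"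
  shows "F' (tangent \<xi>0 (t + u)) = F' (tangent \<xi>0 t) + u * F' (vector [2 * (c * (c * \<xi>0 + d)), 2 * a * c * \<xi>0 + a * d + b * c])"
proof -
  interpret F': Vector_Spaces.linear "(*s)" "(*)" F' by (fact assms)
  have "tangent \<xi>0 (t + u) = tangent \<xi>0 t + u *s vector [2 * (c * (c * \<xi>0 + d)), 2 * a * c * \<xi>0 + a * d + b * c]"
    by (simp add: tangent_def vec_eq_iff forall_2 algebra_simps)
  then show ?thesis by (simp add: F'.add F'.scale)
qed

section \<open>Rigidity of extremal functions\<close>

text \<open>Serves three situations: the unit disc with a member of the pencil, a fibre with
  \<open>f\<close> constant, and an open set of first coordinates with \<open>g\<close>
  constant.\<close>

lemma chart_compose_holomorphic:
  assumes F: "F \<in> disc_maps" and S: "open S" and f: "f holomorphic_on S" and g: "g holomorphic_on S"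
    and mem: "\<And>z. z \<in> S \<Longrightarrow> Re (f z) > 0" "\<And>z. z \<in> S \<Longrightarrow> g z \<in> fibre (f z)"
    and w: "cmod w < 1"
  shows "(\<lambda>z. Moebius_function 0 w (F (chart (f z) (g z)))) holomorphic_on S"
proof -
  have nz: "den (f z) (g z) \<noteq> 0" if "z \<in> S" for z using chart_mem mem that by blast
  have "(\<lambda>z. F (chart (f z) (g z))) holomorphic_on S"
    unfolding chart_def
  proof (rule disc_maps_compose_holomorphic [OF F S])
    show "vector [(2 * a * c * g z + 2 * (a * d + b * c) * f z + 2 * b * d) / den (f z) (g z),
      (a\<^sup>2 * g z + 2 * a * b * f z + b\<^sup>2) / den (f z) (g z)] \<in> symm_bidisc" if "z \<in> S" for z
      using chart_mem(1) [OF mem [OF that]] by (simp add: chart_def)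
  qed (use nz in \<open>auto simp: den_def intro!: holomorphic_intros f g\<close>)
  moreover have "F (chart (f z) (g z)) \<in> ball 0 1" if "z \<in> S" for z
    using disc_maps_norm [OF F chart_mem(1) [OF mem [OF that]]] by simp
  ultimately show ?thesis
    by (intro holomorphic_on_compose_gen [OF _ Moebius_function_holomorphic [OF w, of 0],
          of "\<lambda>z. F (chart (f z) (g z))" S, unfolded o_def]) auto
qed

text \<open>Along the discs with parameter \<open>A\<close> the derivative of a normalised solution is affine in \<open>A\<close>, bounded
  by 1 near \<open>A0\<close> and unimodular at \<open>A0\<close>, hence constant. By the Schwarz lemma the solution is then known
  on a real curve in almost every fibre, and so on the whole fibre.\<close>

lemma extremal_form:
  assumes \<xi>0: "Re \<xi>0 > 0" and adm: "admissible \<xi>0 A0"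
    and v: "tangent \<xi>0 (2 * A0 * Re \<xi>0) = \<mu> *s v"
    and F: "solves_car (chart \<xi>0 1) v F"
  shows "\<exists>e. cmod e = 1 \<and> (\<forall>s\<in>symm_bidisc. Moebius_function 0 (F (chart \<xi>0 1)) (F s) = e * coord \<xi>0 s)"
proof -
  let ?l = "chart \<xi>0 1"
  define w where "w = F ?l"
  define k where "k = \<xi>0 + cnj \<xi>0"
  define K where "K = k * (a * d - b * c) / (den \<xi>0 1)\<^sup>2"
  have k: "k = of_real (2 * Re \<xi>0)" by (simp add: k_def complex_eq_iff)
  have fib1: "1 \<in> fibre \<xi>0" using geodesic_in_fibre [OF adm \<xi>0] by simp
  have l: "?l \<in> symm_bidisc" and den: "den \<xi>0 1 \<noteq> 0" using chart_mem [OF \<xi>0 fib1] by auto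
  have Fd: "F \<in> disc_maps" using F by (simp add: solves_car_def)
  have w: "cmod w < 1" using disc_maps_norm [OF Fd l] by (simp add: w_def)
  then have w2: "1 - (cmod w)\<^sup>2 > 0" by (simp add: power_less_one_iff abs_square_less_1)
  obtain F' where F': "(F has_derivative F') (at ?l)" "Vector_Spaces.linear (*s) (*) F'"
    "\<And>v. dir_deriv v F ?l = F' v"
    using disc_mapsE [OF Fd l] by metis
  interpret F': Vector_Spaces.linear "(*s)" "(*)" F' by (fact F')
  have cd: "coord \<xi>0 \<in> disc_maps" by (rule coord_disc_map [OF \<xi>0])
  obtain Z' where Z': "(coord \<xi>0 has_derivative Z') (at ?l)" "Vector_Spaces.linear (*s) (*) Z'"
    "\<And>v. dir_deriv v (coord \<xi>0) ?l = Z' v"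
    using disc_mapsE [OF cd l] by metis
  interpret Z': Vector_Spaces.linear "(*s)" "(*)" Z' by (fact Z')
  define p where "p A z = geodesic \<xi>0 A (cayley \<xi>0 z)" for A z
  have pd: "(p A has_field_derivative k * of_real (2 * A * Re \<xi>0)) (at 0)" for A
    unfolding p_def [abs_def] geodesic_def
    by (auto intro!: derivative_eq_intros cayley_has_derivative) (simp add: k flip: k_def)
  have p0: "p A 0 = 1" for A by (simp add: p_def)
  have pf: "p A z \<in> fibre (cayley \<xi>0 z)" if "admissible \<xi>0 A" "cmod z < 1" for A z
    unfolding p_def using that geodesic_in_fibre Re_cayley [OF \<xi>0] by blast
  have phol: "p A holomorphic_on ball 0 1" for A
    unfolding p_def [abs_def] geodesic_def by (intro holomorphic_intros cayley_holomorphic)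
  note cf = cayley_has_derivative [of \<xi>0, folded k_def]
  \<comment> \<open>The solution along a disc of the pencil, normalised to fix the origin for the
    Schwarz lemma.\<close>
  define g where "g A z = Moebius_function 0 w (F (chart (cayley \<xi>0 z) (p A z)))" for A z
  have ghol: "g A holomorphic_on ball 0 1" if "admissible \<xi>0 A" for A
    unfolding g_def [abs_def]
    by (rule chart_compose_holomorphic [OF Fd _ _ _ _ _ w])
      (use that pf phol cayley_holomorphic Re_cayley [OF \<xi>0] in auto)
  have g0: "g A 0 = 0" for A by (simp add: g_def p0 w_def Moebius_function_eq_zero)
  have g1: "cmod (g A z) < 1" if "admissible \<xi>0 A" "cmod z < 1" for A z
    unfolding g_def using that pf Re_cayley [OF \<xi>0] chart_mem disc_maps_norm [OF Fd] w
    by (intro Moebius_function_norm_lt_1) auto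
  define D where "D A = K * F' (tangent \<xi>0 (of_real (2 * A * Re \<xi>0))) / of_real (1 - (cmod w)\<^sup>2)" for A
  have gd: "deriv (g A) 0 = D A" for A
  proof -
    have "((\<lambda>z. F (chart (cayley \<xi>0 z) (p A z))) has_field_derivative
        K * F' (tangent \<xi>0 (of_real (2 * A * Re \<xi>0)))) (at 0)"
      unfolding K_def by (rule chart_has_derivative [OF cf pd _ _ den F'(1,2)]) (simp_all add: p0)
    moreover have "(Moebius_function 0 w has_field_derivative 1 / of_real (1 - (cmod w)\<^sup>2))
        (at (F (chart (cayley \<xi>0 0) (p A 0))))"
      using Moebius_function_has_derivative_center [OF w] by (simp add: p0 w_def)
    ultimately have "(g A has_field_derivative 1 / of_real (1 - (cmod w)\<^sup>2) * (K * F' (tangent \<xi>0 (of_real (2 * A * Re \<xi>0))))) (at 0)"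
      unfolding g_def [abs_def] by (rule DERIV_chain2 [rotated])
    then show ?thesis unfolding D_def by (simp add: DERIV_imp_deriv)
  qed
  have D_le: "cmod (D A) \<le> 1" if "admissible \<xi>0 A" for A
    using Schwarz_Lemma(2) [OF ghol [OF that] g0 g1 [OF that], of 0] by (simp add: gd)
  \<comment> \<open>Along the disc \<open>A0\<close> the function \<open>coord \<xi>0\<close> is the
    identity, so its derivative is 1. The direction of this disc is a multiple of \<open>v\<close>,
    where \<open>F\<close> does at least as well as \<open>coord \<xi>0\<close>.\<close>
  have D_ge: "cmod (D A0) \<ge> 1"
  proof -
    have "((\<lambda>z. coord \<xi>0 (chart (cayley \<xi>0 z) (p A0 z))) has_field_derivative
        K * Z' (tangent \<xi>0 (of_real (2 * A0 * Re \<xi>0)))) (at 0)"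
      unfolding K_def by (rule chart_has_derivative [OF cf pd _ _ den Z'(1,2)]) (simp_all add: p0)
    moreover have "((\<lambda>z. coord \<xi>0 (chart (cayley \<xi>0 z) (p A0 z))) has_field_derivative 1) (at 0)"
    proof (rule has_field_derivative_transform_within_open [OF DERIV_ident, where S = "ball 0 1"])
      fix z :: complex assume "z \<in> ball 0 1"
      then show "z = coord \<xi>0 (chart (cayley \<xi>0 z) (p A0 z))"
        using coord_chart(1) [OF \<xi>0 _ pf [OF adm]] Re_cayley [OF \<xi>0] cayley_coord [OF \<xi>0] by simp
    qed auto
    ultimately have "K * Z' (tangent \<xi>0 (of_real (2 * A0 * Re \<xi>0))) = 1" by (rule DERIV_unique)
    then have one: "cmod (K * \<mu>) * cmod (Z' v) = 1"
      using v by (simp add: Z'.scale flip: norm_mult) (simp add: algebra_simps)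
    have "coord \<xi>0 ?l = 0" using coord_chart(1) [OF \<xi>0 \<xi>0 fib1] by simp
    then have "cmod (Z' v) \<le> cmod (F' v) / (1 - (cmod w)\<^sup>2)"
      using solves_car_ge [OF F cd] by (simp add: car_quotient_def F' Z' w_def)
    then have le: "cmod (K * \<mu>) * cmod (Z' v) \<le> cmod (K * \<mu>) * (cmod (F' v) / (1 - (cmod w)\<^sup>2))"
      by (intro mult_left_mono) auto
    have "D A0 = K * (\<mu> * F' v) / of_real (1 - (cmod w)\<^sup>2)"
      using v by (simp only: D_def F'.scale)
    then have "cmod (K * \<mu>) * (cmod (F' v) / (1 - (cmod w)\<^sup>2)) = cmod (D A0)"
      using w2 by (simp only: norm_mult norm_divide norm_of_real abs_of_pos) (simp add: mult.assoc)
    with le one show ?thesis by simp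
  qed
  obtain \<epsilon> where \<epsilon>: "\<epsilon> > 0" "\<And>A. \<bar>A - A0\<bar> < \<epsilon> \<Longrightarrow> admissible \<xi>0 A"
    using open_admissible [of \<xi>0, unfolded open_dist] adm by (auto simp: dist_real_def)
  obtain E where E: "D A = D A0 + of_real (A - A0) * E" for A
  proof
    fix A
    have t: "complex_of_real (2 * A * Re \<xi>0) = of_real (2 * A0 * Re \<xi>0) + of_real (2 * (A - A0) * Re \<xi>0)"
      by (simp flip: of_real_add add: algebra_simps)
    show "D A = D A0 + of_real (A - A0) * (K * (of_real (2 * Re \<xi>0) *
        F' (vector [2 * (c * (c * \<xi>0 + d)), 2 * a * c * \<xi>0 + a * d + b * c])) / of_real (1 - (cmod w)\<^sup>2))"
      unfolding D_def t tangent_affine [OF F'(2)]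
      by (simp add: add_divide_distrib diff_divide_distrib algebra_simps)
  qed
  have D0: "cmod (D A0) = 1" using D_le [OF adm] D_ge by simp
  \<comment> \<open>The parameters \<open>A0 + \<epsilon> / 2\<close> and
    \<open>A0 - \<epsilon> / 2\<close> are both admissible, so the unimodular \<open>D A0\<close> is
    the midpoint of two points of the closed disc.\<close>
  have "of_real (\<epsilon> / 2) * E = 0"
  proof (rule eq_0_if_norm_add_diff_le [OF D0])
    show "cmod (D A0 + of_real (\<epsilon> / 2) * E) \<le> 1"
      using D_le [OF \<epsilon>(2), of "A0 + \<epsilon> / 2"] \<epsilon>(1) E [of "A0 + \<epsilon> / 2"] by simp
    show "cmod (D A0 - of_real (\<epsilon> / 2) * E) \<le> 1"
      using D_le [OF \<epsilon>(2), of "A0 - \<epsilon> / 2"] \<epsilon>(1) E [of "A0 - \<epsilon> / 2"] by simp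
  qed
  then have "E = 0" using \<epsilon>(1) by simp
  then have DA: "deriv (g A) 0 = D A0" for A using E [of A] gd [of A] by simp
  \<comment> \<open>Equality in the Schwarz lemma makes each \<open>g A\<close> a rotation, and
    \<open>E = 0\<close> makes it the same rotation for all \<open>A\<close>.\<close>
  have glin: "g A z = D A0 * z" if A: "\<bar>A - A0\<bar> < \<epsilon>" and z: "cmod z < 1" for A z
  proof -
    note adA = \<epsilon>(2) [OF A]
    have "cmod (deriv (g A) 0) = 1" using D0 DA by simp
    then obtain \<alpha> where \<alpha>: "\<And>z. cmod z < 1 \<Longrightarrow> g A z = \<alpha> * z"
      using Schwarz_Lemma(3) [OF ghol [OF adA] g0 g1 [OF adA], of 0] by auto
    have "(g A has_field_derivative \<alpha>) (at 0)"
      by (rule has_field_derivative_transform_within_open [of "\<lambda>z. \<alpha> * z" _ _ "ball 0 1"])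
        (auto intro!: derivative_eq_intros simp: \<alpha>)
    then have "\<alpha> = D A0" using DA [of A] DERIV_imp_deriv by metis
    then show ?thesis using \<alpha> z by simp
  qed
  define H where "H \<xi> q = Moebius_function 0 w (F (chart \<xi> q)) - D A0 * ((\<xi> - \<xi>0) / (\<xi> + cnj \<xi>0))" for \<xi> q
  \<comment> \<open>Over \<open>\<xi> \<noteq> \<xi>0\<close> the neighbouring discs cut the fibre
    in a nondegenerate segment, from which the identity theorem spreads the zeros. Over
    \<open>\<xi>0\<close> this segment shrinks to the point 1.\<close>
  have H0: "H \<xi> q = 0" if \<xi>: "Re \<xi> > 0" "\<xi> \<noteq> \<xi>0" and q: "q \<in> fibre \<xi>" for \<xi> q
  proof (rule analytic_continuation [where f = "H \<xi>" and S = "fibre \<xi>"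
        and U = "(\<lambda>A. geodesic \<xi>0 A \<xi>) ` {A. \<bar>A - A0\<bar> < \<epsilon>}" and \<xi> = "geodesic \<xi>0 A0 \<xi>"])
    show "H \<xi> holomorphic_on fibre \<xi>"
      unfolding H_def [abs_def]
      by (intro holomorphic_intros chart_compose_holomorphic [OF Fd open_fibre _ _ _ _ w]) (use \<xi> in auto)
    show "open (fibre \<xi>)" "connected (fibre \<xi>)" "q \<in> fibre \<xi>"
      using open_fibre convex_fibre convex_connected q by auto
    show "(\<lambda>A. geodesic \<xi>0 A \<xi>) ` {A. \<bar>A - A0\<bar> < \<epsilon>} \<subseteq> fibre \<xi>"
      using geodesic_in_fibre [OF \<epsilon>(2) \<xi>(1)] by auto
    show "geodesic \<xi>0 A0 \<xi> \<in> fibre \<xi>" by (rule geodesic_in_fibre [OF adm \<xi>(1)])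
    define N where "N = (\<xi> - \<xi>0) * (\<xi> + cnj \<xi>0)"
    have "Re (\<xi> + cnj \<xi>0) \<noteq> 0" using \<xi> \<xi>0 by simp
    then have nz: "\<xi> + cnj \<xi>0 \<noteq> 0" by (metis zero_complex.sel(1))
    then have N: "N \<noteq> 0" using \<xi> by (simp add: N_def)
    show "geodesic \<xi>0 A0 \<xi> islimpt (\<lambda>A. geodesic \<xi>0 A \<xi>) ` {A. \<bar>A - A0\<bar> < \<epsilon>}"
      unfolding islimpt_approachable
    proof (intro allI impI)
      fix \<delta> :: real assume \<delta>: "\<delta> > 0"
      \<comment> \<open>The first bound keeps \<open>A0 + h\<close> within \<open>\<epsilon>\<close>
        of \<open>A0\<close>, the second keeps the displacement \<open>h * N\<close> below
        \<open>\<delta>\<close>.\<close>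
      define h where "h = min (\<epsilon> / 2) (\<delta> / (2 * cmod N))"
      have h: "h > 0" "h < \<epsilon>" "h * cmod N < \<delta>"
      proof -
        show "h > 0" "h < \<epsilon>" using \<epsilon>(1) \<delta> N by (auto simp: h_def min_def)
        have "h * cmod N \<le> \<delta> / (2 * cmod N) * cmod N" by (intro mult_right_mono) (auto simp: h_def)
        also have "\<dots> < \<delta>" using \<delta> N by simp
        finally show "h * cmod N < \<delta>" .
      qed
      have "geodesic \<xi>0 (A0 + h) \<xi> - geodesic \<xi>0 A0 \<xi> = of_real h * N"
        by (simp add: geodesic_def N_def algebra_simps)
      moreover have "cmod (of_real h * N) < \<delta>" "of_real h * N \<noteq> 0" using h N by (simp_all add: norm_mult)
      ultimately show "\<exists>x'\<in>(\<lambda>A. geodesic \<xi>0 A \<xi>) ` {A. \<bar>A - A0\<bar> < \<epsilon>}. x' \<noteq> geodesic \<xi>0 A0 \<xi> \<and> dist x' (geodesic \<xi>0 A0 \<xi>) < \<delta>"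
        using h by (intro bexI [of _ "geodesic \<xi>0 (A0 + h) \<xi>"]) (auto simp: dist_norm)
    qed
    fix q assume "q \<in> (\<lambda>A. geodesic \<xi>0 A \<xi>) ` {A. \<bar>A - A0\<bar> < \<epsilon>}"
    then obtain A where A: "\<bar>A - A0\<bar> < \<epsilon>" "q = geodesic \<xi>0 A \<xi>" by auto
    show "H \<xi> q = 0"
      using glin [OF A(1) cayley_inverse(2) [OF \<xi>0 \<xi>(1)]]
      by (simp add: H_def A(2) g_def p_def cayley_inverse(1) [OF \<xi>0 \<xi>(1)])
  qed
  \<comment> \<open>The remaining fibre follows by continuity in \<open>\<xi>\<close> with
    \<open>q\<close> fixed, since \<open>q \<in> fibre \<xi>\<close> is an open condition on
    \<open>\<xi>\<close>.\<close>
  have H0': "H \<xi>0 q = 0" if q: "q \<in> fibre \<xi>0" for q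
  proof -
    define S where "S = {\<xi>. Re \<xi> > 0} \<inter> {\<xi>. q \<in> fibre \<xi>}"
    have S: "open S" "\<xi>0 \<in> S"
      unfolding S_def fibre_def mem_Collect_eq
      by (intro open_Int open_Collect_less continuous_intros) (use q \<xi>0 in \<open>auto simp: fibre_def\<close>)
    have "Re (\<xi> + cnj \<xi>0) \<noteq> 0" if "\<xi> \<in> S" for \<xi> using that \<xi>0 by (simp add: S_def)
    then have nz: "\<xi> + cnj \<xi>0 \<noteq> 0" if "\<xi> \<in> S" for \<xi> using that by (metis zero_complex.sel(1))
    have "(\<lambda>\<xi>. H \<xi> q) holomorphic_on S"
      unfolding H_def [abs_def]
      by (intro holomorphic_intros chart_compose_holomorphic [OF Fd S(1) _ _ _ _ w]) (auto simp: S_def nz)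
    then have "((\<lambda>\<xi>. H \<xi> q) \<longlongrightarrow> H \<xi>0 q) (at \<xi>0)"
      using S holomorphic_on_imp_continuous_on continuous_on_eq_continuous_at isCont_def by blast
    moreover have "eventually (\<lambda>\<xi>. H \<xi> q = 0) (at \<xi>0)"
      unfolding eventually_at_topological using S by (intro exI [of _ S]) (auto simp: S_def H0)
    then have "((\<lambda>\<xi>. H \<xi> q) \<longlongrightarrow> 0) (at \<xi>0)" by (rule tendsto_eventually)
    ultimately show ?thesis by (metis LIM_unique)
  qed
  show ?thesis
  proof (intro exI conjI ballI)
    show "cmod (D A0) = 1" by (fact D0)
    fix s :: "complex^2" assume "s \<in> symm_bidisc"
    then obtain \<xi> q where x: "Re \<xi> > 0" "q \<in> fibre \<xi>" "s = chart \<xi> q" using chart_surj by metis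
    then have "H \<xi> q = 0" using H0 H0' by metis
    then show "Moebius_function 0 (F ?l) (F s) = D A0 * coord \<xi>0 s"
      unfolding x(3) coord_chart(1) [OF \<xi>0 x(1,2)] by (simp add: H_def w_def)
  qed
qed

text \<open>After normalisation both solutions are rotations of the same
  \<open>coord \<xi>0\<close>; eliminating it leaves a Moebius map from \<open>F1\<close> to
  \<open>F2\<close>.\<close>

lemma solutions_equivalent:
  assumes \<xi>0: "Re \<xi>0 > 0" and adm: "admissible \<xi>0 A0"
    and v: "tangent \<xi>0 (2 * A0 * Re \<xi>0) = \<mu> *s v"
    and F1: "solves_car (chart \<xi>0 1) v F1" and F2: "solves_car (chart \<xi>0 1) v F2"
  shows "\<exists>m. disc_automorphism m \<and> (\<forall>s\<in>symm_bidisc. F2 s = m (F1 s))"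
proof -
  have l: "chart \<xi>0 1 \<in> symm_bidisc" 
    using geodesic_in_fibre [OF adm \<xi>0] chart_mem(1) [OF \<xi>0] by simp
  have d: "F1 \<in> disc_maps" "F2 \<in> disc_maps" using F1 F2 by (auto simp: solves_car_def)
  define w1 w2 where "w1 = F1 (chart \<xi>0 1)" and "w2 = F2 (chart \<xi>0 1)"
  have w: "cmod w1 < 1" "cmod w2 < 1" using disc_maps_norm [OF _ l] d by (auto simp: w1_def w2_def)
  obtain e1 where e1: "cmod e1 = 1" "\<And>s. s \<in> symm_bidisc \<Longrightarrow> Moebius_function 0 w1 (F1 s) = e1 * coord \<xi>0 s"
    using extremal_form [OF \<xi>0 adm v F1] by (auto simp: w1_def)
  obtain e2 where e2: "cmod e2 = 1" "\<And>s. s \<in> symm_bidisc \<Longrightarrow> Moebius_function 0 w2 (F2 s) = e2 * coord \<xi>0 s"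
    using extremal_form [OF \<xi>0 adm v F2] by (auto simp: w2_def)
  have "F2 s = Moebius_function 0 (- w2) (e2 / e1 * Moebius_function 0 w1 (F1 s))" if s: "s \<in> symm_bidisc" for s
  proof -
    have "e2 / e1 * Moebius_function 0 w1 (F1 s) = Moebius_function 0 w2 (F2 s)"
      using e1(1) by (auto simp: e1(2) [OF s] e2(2) [OF s])
    then show ?thesis
      using Moebius_function_compose [of "- w2" w2 "F2 s"] w disc_maps_norm [OF d(2) s] by simp
  qed
  moreover have "disc_automorphism (\<lambda>z. Moebius_function 0 (- w2) (e2 / e1 * Moebius_function 0 w1 z))"
    using w e1 e2 by (intro disc_automorphismI) (auto simp: norm_divide)
  ultimately show ?thesis by blast
qed

end

subsection \<open>The chart adapted to a generic direction\<close>

text \<open>The coefficients are those of \<open>y \<mapsto> \<omega> * (y - 1) / (y + 1)\<close>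
  followed by the disc automorphism \<open>z \<mapsto> (z + a) / (1 + cnj a * z)\<close>.\<close>

lemma half_plane_chart_moebius:
  assumes a: "cmod a < 1" and \<omega>: "cmod \<omega> = 1"
  shows "half_plane_chart (a + \<omega>) (a - \<omega>) (1 + cnj a * \<omega>) (1 - cnj a * \<omega>)"
proof
  have a2: "0 < 1 - (cmod a)\<^sup>2" using a by (simp add: power_less_one_iff abs_square_less_1)
  \<comment> \<open>Homogeneous form of the invariance of the disc, applied to
    \<open>U = y + 1\<close>, \<open>V = \<omega> * (y - 1)\<close> and to \<open>U = 1\<close>,
    \<open>V = - x\<close>.\<close>
  have *: "(cmod (U + cnj a * V))\<^sup>2 - (cmod (a * U + V))\<^sup>2 = (1 - (cmod a)\<^sup>2) * ((cmod U)\<^sup>2 - (cmod V)\<^sup>2)" for U V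
    unfolding cmod_power2 by (simp add: power2_eq_square algebra_simps)
  have less: "cmod (a * U + V) < cmod (U + cnj a * V)" if "cmod V < cmod U" for U V
  proof -
    have "(cmod V)\<^sup>2 < (cmod U)\<^sup>2" using that by (intro power_strict_mono) auto
    then have "(cmod (a * U + V))\<^sup>2 < (cmod (U + cnj a * V))\<^sup>2"
      using * [of U V] mult_pos_pos [OF a2, of "(cmod U)\<^sup>2 - (cmod V)\<^sup>2"] by simp
    then show ?thesis by (rule power_less_imp_less_base) simp
  qed
  show "cmod ((a + \<omega>) * y + (a - \<omega>)) < cmod ((1 + cnj a * \<omega>) * y + (1 - cnj a * \<omega>))" if "Re y > 0" for y
  proof -
    have "(cmod (y - 1))\<^sup>2 < (cmod (y + 1))\<^sup>2"
      using that unfolding cmod_power2 by (simp add: power2_eq_square algebra_simps)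
    then have "cmod (y - 1) < cmod (y + 1)" by (rule power_less_imp_less_base) simp
    then have "cmod (\<omega> * (y - 1)) < cmod (y + 1)" using \<omega> by (simp add: norm_mult)
    from less [OF this] show ?thesis by (simp only: algebra_simps mult_1_left mult_1_right)
  qed
  show "a + \<omega> - (1 + cnj a * \<omega>) * x \<noteq> 0 \<and>
      Re (((1 - cnj a * \<omega>) * x - (a - \<omega>)) / (a + \<omega> - (1 + cnj a * \<omega>) * x)) > 0" if x: "cmod x < 1" for x
  proof -
    define X Y where "X = x - a" and "Y = \<omega> * (1 - cnj a * x)"
    have "cmod X < cmod (1 - cnj a * x)"
      using less [of "- x" 1] x by (simp add: X_def norm_minus_commute)
    then have XY: "cmod X < cmod Y" using \<omega> by (simp add: Y_def norm_mult)
    then have nz: "Y - X \<noteq> 0" by auto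
    have "Re ((Y + X) * cnj (Y - X)) = (cmod Y)\<^sup>2 - (cmod X)\<^sup>2"
      unfolding cmod_power2 by (simp add: power2_eq_square algebra_simps)
    also have "\<dots> > 0" using XY by (simp add: power_strict_mono)
    finally have "Re ((Y + X) / (Y - X)) > 0" by (simp add: Re_complex_div_gt_0)
    moreover have "Y + X = (1 - cnj a * \<omega>) * x - (a - \<omega>)" "Y - X = a + \<omega> - (1 + cnj a * \<omega>) * x"
      by (simp_all add: X_def Y_def algebra_simps)
    ultimately show ?thesis using nz by simp
  qed
  have "(a + \<omega>) * (1 - cnj a * \<omega>) - (a - \<omega>) * (1 + cnj a * \<omega>) = 2 * \<omega> * (1 - a * cnj a)"
    by (simp add: algebra_simps)
  also have "1 - a * cnj a = of_real (1 - (cmod a)\<^sup>2)"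
    by (simp only: of_real_diff of_real_1 complex_norm_square)
  finally show "(a + \<omega>) * (1 - cnj a * \<omega>) - (a - \<omega>) * (1 + cnj a * \<omega>) \<noteq> 0"
    using \<omega> a2 by (metis less_irrefl mult_eq_0_iff norm_zero of_real_eq_0_iff zero_neq_numeral zero_neq_one)
qed

section \<open>Moving the base point\<close>

text \<open>Here \<open>a\<close> is the hyperbolic midpoint of the two disc points: the
  automorphism sending \<open>a\<close> to 0 takes them to \<open>y\<close> and \<open>- y\<close>,
  and the base point to \<open>(0, P)\<close> with \<open>P = - y\<^sup>2\<close>.\<close>

lemma symm_bidisc_midpoint:
  assumes "l \<in> symm_bidisc"
  obtains a P where "cmod a < 1" "cmod P < 1" "1 + (cnj a)\<^sup>2 * P \<noteq> 0"
    "l = vector [2 * (a + cnj a * P) / (1 + (cnj a)\<^sup>2 * P), (P + a\<^sup>2) / (1 + (cnj a)\<^sup>2 * P)]"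
proof -
  obtain x1 x2 where x: "cmod x1 < 1" "cmod x2 < 1" and l: "l = vector [x1 + x2, x1 * x2]"
    using assms by (auto simp: symm_bidisc_def)
  define s p where "s = x1 + x2" and "p = x1 * x2"
  have p1: "cmod p < 1" using norm_mult_less [OF x] by (simp add: p_def)
  then have p2: "0 < 1 - (cmod p)\<^sup>2" by (simp add: power_less_one_iff abs_square_less_1)
  have pc: "of_real (1 - (cmod p)\<^sup>2) = 1 - p * cnj p"
    by (simp only: of_real_diff of_real_1 complex_norm_square)
  \<comment> \<open>Obtained by solving \<open>s = \<beta> + cnj \<beta> * p\<close> together with
    its conjugate.\<close>
  define \<beta> where "\<beta> = (s - cnj s * p) / of_real (1 - (cmod p)\<^sup>2)"
  have \<beta>1: "cmod \<beta> < 1"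
  proof -
    have "s - cnj s * p = x1 * of_real (1 - (cmod x2)\<^sup>2) + x2 * of_real (1 - (cmod x1)\<^sup>2)"
      unfolding of_real_diff of_real_1 complex_norm_square by (simp add: s_def p_def algebra_simps)
    moreover have "0 < 1 - (cmod x1)\<^sup>2" "0 < 1 - (cmod x2)\<^sup>2" using x by (simp_all add: power_less_one_iff abs_square_less_1)
    ultimately have "cmod (s - cnj s * p) \<le> cmod x1 * (1 - (cmod x2)\<^sup>2) + cmod x2 * (1 - (cmod x1)\<^sup>2)"
      using norm_triangle_ineq [of "x1 * of_real (1 - (cmod x2)\<^sup>2)" "x2 * of_real (1 - (cmod x1)\<^sup>2)"]
      by (simp only: norm_mult norm_of_real abs_of_pos)
    also have "\<dots> = (cmod x1 + cmod x2) * (1 - cmod p)"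
      by (simp add: p_def norm_mult power2_eq_square algebra_simps)
    also have "\<dots> < (1 + cmod p) * (1 - cmod p)"
    proof (rule mult_strict_right_mono)
      have "(1 - cmod x1) * (1 - cmod x2) > 0" using x by simp
      then show "cmod x1 + cmod x2 < 1 + cmod p" by (simp add: p_def norm_mult algebra_simps)
    qed (use p1 in simp)
    also have "\<dots> = 1 - (cmod p)\<^sup>2" by (simp add: power2_eq_square algebra_simps)
    finally show ?thesis using p2 by (simp only: \<beta>_def norm_divide norm_of_real abs_of_pos) simp
  qed
  have pnz: "1 - p * cnj p \<noteq> 0" using p2 pc by (metis less_irrefl of_real_eq_0_iff)
  have s: "s = \<beta> + cnj \<beta> * p"
  proof -
    have "cnj \<beta> = (cnj s - s * cnj p) / (1 - p * cnj p)"
      unfolding \<beta>_def complex_cnj_divide complex_cnj_complex_of_real unfolding pc by simp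
    then have "\<beta> + cnj \<beta> * p = (s - cnj s * p + (cnj s - s * cnj p) * p) / (1 - p * cnj p)"
      by (simp only: \<beta>_def pc add_divide_distrib times_divide_eq_left)
    also have "\<dots> = s" using pnz by (simp add: divide_eq_eq) (simp add: algebra_simps)
    finally show ?thesis by simp
  qed
  define q where "q = sqrt (1 - (cmod \<beta>)\<^sup>2)"
  have q: "q \<ge> 0" "q\<^sup>2 = 1 - (cmod \<beta>)\<^sup>2" using \<beta>1 by (simp_all add: q_def power_le_one)
  \<comment> \<open>Solves \<open>\<beta> = 2 * a / (1 + (cmod a)\<^sup>2)\<close>; the sign of
    \<open>q\<close> selects the solution inside the disc.\<close>
  define a where "a = \<beta> / of_real (1 + q)"
  have a1: "cmod a < 1"
    using \<beta>1 q by (simp add: a_def norm_divide del: of_real_add)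
  have "1 + (cmod a)\<^sup>2 = 2 / (1 + q)"
  proof -
    have "(cmod a)\<^sup>2 = (1 - q\<^sup>2) / (1 + q)\<^sup>2"
      using q by (simp add: a_def norm_divide power_divide del: of_real_add)
    also have "\<dots> = ((1 - q) * (1 + q)) / ((1 + q) * (1 + q))"
      by (simp add: power2_eq_square algebra_simps)
    also have "\<dots> = (1 - q) / (1 + q)" using q(1) by simp
    finally show ?thesis using q(1) by (simp add: field_simps)
  qed
  moreover have "\<beta> = of_real (1 + q) * a" using q by (simp add: a_def del: of_real_add)
  ultimately have "of_real (1 + (cmod a)\<^sup>2) * \<beta> = (of_real (2 / (1 + q)) * of_real (1 + q)) * a"
    by (simp only: mult.assoc)
  also have "of_real (2 / (1 + q)) * of_real (1 + q) = complex_of_real 2"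
    unfolding of_real_mult [symmetric] using q(1) by (intro arg_cong [where f = of_real]) (simp add: field_simps)
  finally have ab: "(1 + a * cnj a) * \<beta> = 2 * a"
    unfolding of_real_add of_real_1 complex_norm_square by simp
  then have ab': "(1 + a * cnj a) * cnj \<beta> = 2 * cnj a"
    by (metis complex_cnj_add complex_cnj_cnj complex_cnj_mult complex_cnj_numeral complex_cnj_one mult.commute)
  have "(1 + a * cnj a) * s = (1 + a * cnj a) * \<beta> + (1 + a * cnj a) * cnj \<beta> * p"
    unfolding s by (simp only: distrib_left mult.assoc)
  then have mid: "(1 + a * cnj a) * s = 2 * a + 2 * cnj a * p"
    unfolding ab ab' .
  define y where "y = (x1 - a) / (1 - cnj a * x1)"
  have M: "cmod y < 1" using Moebius_function_norm_lt_1 [OF a1 x(1), of 0] by (simp add: y_def Moebius_function_simple)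
  have nz: "1 - cnj a * u \<noteq> 0" "1 + cnj a * u \<noteq> 0" if "cmod u < 1" for u
  proof -
    have "cmod (cnj a * u) < 1" using norm_mult_less [of "cnj a" 1 u 1] a1 that by simp
    then show "1 - cnj a * u \<noteq> 0" "1 + cnj a * u \<noteq> 0"
      by (metis less_irrefl norm_one right_minus_eq, metis add_eq_0_iff less_irrefl norm_minus_cancel norm_one)
  qed
  have "(x1 - a) * (1 - cnj a * x2) + (x2 - a) * (1 - cnj a * x1) = 0"
    using mid by (simp add: s_def p_def algebra_simps)
  then have y2: "(x2 - a) / (1 - cnj a * x2) = - y"
    using nz(1) [OF x(1)] nz(1) [OF x(2)] by (simp add: y_def field_simps eq_neg_iff_add_eq_0)
  have x1: "x1 = (y + a) / (1 + cnj a * y)"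
    using Moebius_function_compose [of "- a" a x1] a1 x(1) by (simp add: Moebius_function_simple y_def)
  have x2: "x2 = (a - y) / (1 - cnj a * y)"
    using Moebius_function_compose [of "- a" a x2] a1 x(2) by (simp add: Moebius_function_simple y2)
  have d: "1 + (cnj a)\<^sup>2 * (- y\<^sup>2) = (1 + cnj a * y) * (1 - cnj a * y)"
    by (simp add: power2_eq_square algebra_simps)
  note nzy = nz [OF M]
  show ?thesis
  proof (rule that [of a "- y\<^sup>2"])
    show "cmod (- y\<^sup>2) < 1" using M by (simp add: norm_power power_less_one_iff)
    show "1 + (cnj a)\<^sup>2 * (- y\<^sup>2) \<noteq> 0" unfolding d using nzy by simp
    have "x1 + x2 = 2 * (a + cnj a * (- y\<^sup>2)) / ((1 + cnj a * y) * (1 - cnj a * y))"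
      using nzy unfolding x1 x2 by (simp add: add_frac_eq) (simp add: power2_eq_square algebra_simps)
    moreover have "x1 * x2 = (- y\<^sup>2 + a\<^sup>2) / ((1 + cnj a * y) * (1 - cnj a * y))"
      unfolding x1 x2 by (simp add: power2_eq_square algebra_simps)
    ultimately show "l = vector [2 * (a + cnj a * (- y\<^sup>2)) / (1 + (cnj a)\<^sup>2 * (- y\<^sup>2)),
        (- y\<^sup>2 + a\<^sup>2) / (1 + (cnj a)\<^sup>2 * (- y\<^sup>2))]"
      unfolding d l by simp
  qed (fact a1)
qed

section \<open>Normals to an ellipse\<close>

text \<open>\<open>e\<close> traces the ellipse with real semi-axis \<open>1 - p\<close> and
  imaginary semi-axis \<open>1 + p\<close>, \<open>n\<close> is its outward normal, and
  \<open>g \<tau> = 0\<close> puts \<open>q\<close> on the normal line at \<open>e \<tau>\<close>.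
  Opposite signs of \<open>g\<close> at the real vertices yield a foot on the upper half.\<close>

lemma ellipse_normal_neg:
  fixes p :: real
  assumes p: "0 \<le> p" "p < 1" and q: "Im q < 0"
  shows "\<exists>\<sigma> r. cmod \<sigma> = 1 \<and> r > (1 + p) / (1 - p) \<and>
    q = (\<sigma> - cnj \<sigma> * p) - of_real r * (\<sigma> + cnj \<sigma> * p)"
proof -
  define e n where "e \<tau> = cis \<tau> - cnj (cis \<tau>) * of_real p" and "n \<tau> = cis \<tau> + cnj (cis \<tau>) * of_real p" for \<tau>
  define g where "g \<tau> = Im ((q - e \<tau>) * cnj (n \<tau>))" for \<tau>
  have "\<exists>\<tau>\<ge>0. \<tau> \<le> pi \<and> g \<tau> = 0"
  proof (rule IVT')
    show "g 0 \<le> 0" using p q by (simp add: g_def e_def n_def mult_nonpos_nonneg)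
    show "0 \<le> g pi" using p q by (simp add: g_def e_def n_def mult_nonpos_nonpos)
    show "continuous_on {0..pi} g"
      unfolding g_def [abs_def] e_def n_def by (intro continuous_intros)
  qed simp
  then obtain \<tau> where \<tau>: "0 \<le> \<tau>" "\<tau> \<le> pi" "g \<tau> = 0" by blast
  have sin: "sin \<tau> \<ge> 0" using \<tau> sin_ge_zero by blast
  have n0: "n \<tau> \<noteq> 0"
  proof
    assume "n \<tau> = 0"
    then have "cmod (cis \<tau>) = cmod (cnj (cis \<tau>) * of_real p)" by (metis add_eq_0_iff2 n_def norm_minus_cancel)
    then show False using p by (simp add: norm_mult)
  qed
  define r where "r = - Re ((q - e \<tau>) / n \<tau>)"
  have "Im ((q - e \<tau>) / n \<tau>) = 0"
    using \<tau>(3) by (simp add: g_def Im_complex_div_eq_0)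
  then have "(q - e \<tau>) / n \<tau> = - of_real r" by (simp add: r_def complex_eq_iff)
  then have qe: "q = e \<tau> - of_real r * n \<tau>" using n0 by (simp add: field_simps)
  have "Im (e \<tau> - of_real r * n \<tau>) = sin \<tau> * ((1 + p) - r * (1 - p))"
    by (simp add: e_def n_def algebra_simps)
  then have "Im q = sin \<tau> * ((1 + p) - r * (1 - p))" by (simp only: qe)
  then have "(1 + p) - r * (1 - p) < 0" using q sin by (metis mult_nonneg_nonneg not_less)
  then have "r > (1 + p) / (1 - p)" using p by (simp add: field_simps)
  then show ?thesis using qe unfolding e_def n_def by (intro exI [of _ "cis \<tau>"] exI [of _ r]) simp
qed

text \<open>The extremal parameter is the foot of a normal from \<open>q\<close> to the far side of the ellipse
  \<open>\<sigma> - p * cnj \<sigma>\<close>; the bound on \<open>r\<close> says that the minor axis has been crossed.\<close>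

lemma ellipse_normal:
  fixes p :: real
  assumes p: "0 \<le> p" "p < 1" and q: "Im q \<noteq> 0"
  obtains \<sigma> r where "cmod \<sigma> = 1" "r > (1 + p) / (1 - p)"
    "q = (\<sigma> - cnj \<sigma> * p) - of_real r * (\<sigma> + cnj \<sigma> * p)"
proof (cases "Im q < 0")
  case True
  then show ?thesis using ellipse_normal_neg [OF p True] that by blast
next
  case False
  then have "Im (- q) < 0" using q by simp
  then obtain \<sigma> r where *: "cmod \<sigma> = 1" "r > (1 + p) / (1 - p)"
    "- q = (\<sigma> - cnj \<sigma> * p) - of_real r * (\<sigma> + cnj \<sigma> * p)"
    using ellipse_normal_neg [OF p] by blast
  then have "q = (- \<sigma> - cnj (- \<sigma>) * p) - of_real r * (- \<sigma> + cnj (- \<sigma>) * p)"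
    by (simp add: algebra_simps)
  then show ?thesis using that [of "- \<sigma>" r] * by simp
qed

text \<open>For this \<open>A\<close> the gap in the admissibility inequality factors. The factor
  \<open>r * (1 - p) - (1 + p)\<close> is positive by the bound on \<open>r\<close>, the others
  because \<open>r > 1\<close> and \<open>p < 1\<close>.\<close>

lemma admissible_base:
  fixes r :: real
  assumes P: "cmod P < 1" and r: "r > (1 + cmod P) / (1 - cmod P)" and \<xi>0: "\<xi>0 = (1 - P) / (1 + P)"
  shows "Re \<xi>0 > 0" "admissible \<xi>0 (1 / (r * Re \<xi>0))"
proof -
  define p N where "p = cmod P" and "N = (cmod (1 + P))\<^sup>2"
  have p: "0 \<le> p" "p < 1" using P by (auto simp: p_def)
  have p2: "0 < 1 - p\<^sup>2" using p by (simp add: power_less_one_iff abs_square_less_1)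
  have "1 + P \<noteq> 0" using P by (metis add_eq_0_iff less_irrefl norm_minus_cancel norm_one)
  then have N: "N > 0" by (simp add: N_def)
  have "Re \<xi>0 = Re ((1 - P) * cnj (1 + P)) / N"
    unfolding \<xi>0 N_def by (simp add: Re_complex_div_eq_0 complex_div_cnj [of "1 - P"])
  also have "Re ((1 - P) * cnj (1 + P)) = 1 - p\<^sup>2"
    unfolding p_def cmod_power2 by (simp add: power2_eq_square algebra_simps)
  finally have Re: "Re \<xi>0 = (1 - p\<^sup>2) / N" .
  then show R: "Re \<xi>0 > 0" using p2 N by simp
  have rp: "r * (1 - p) > 1 + p" using r p by (simp add: p_def field_simps)
  have "(1 + p) / (1 - p) \<ge> 1" using p by simp
  then have r1: "r > 1" using r unfolding p_def [symmetric] by linarith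
  define A where "A = 1 / (r * Re \<xi>0)"
  have A0: "A > 0" using R r1 by (simp add: A_def)
  have AR: "A * Re \<xi>0 = 1 / r" using R by (simp add: A_def)
  have A: "A = N / (r * (1 - p\<^sup>2))" by (simp add: A_def Re)
  have "N \<le> (1 + p)\<^sup>2"
    unfolding N_def p_def by (intro power_mono) (use norm_triangle_ineq [of 1 P] in auto)
  also have "\<dots> < r * (1 - p\<^sup>2)"
    using mult_strict_right_mono [OF rp, of "1 + p"] p by (simp add: power2_eq_square algebra_simps)
  finally have A1: "A < 1" unfolding A using p2 r1 by simp
  have x2: "(cmod \<xi>0)\<^sup>2 = (2 + 2 * p\<^sup>2) / N - 1"
  proof -
    have "(cmod \<xi>0)\<^sup>2 = (cmod (1 - P))\<^sup>2 / N" by (simp add: \<xi>0 N_def norm_divide power_divide)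
    also have "(cmod (1 - P))\<^sup>2 = 2 + 2 * p\<^sup>2 - N"
      unfolding N_def p_def cmod_power2 by (simp add: power2_eq_square algebra_simps)
    finally show ?thesis using N by (simp add: diff_divide_distrib)
  qed
  have "(1 - A) * (1 - A * (cmod \<xi>0)\<^sup>2) - (A * Im \<xi>0)\<^sup>2 = 1 - A * (1 + (cmod \<xi>0)\<^sup>2) + (A * Re \<xi>0)\<^sup>2"
    unfolding cmod_power2 by (simp add: power2_eq_square algebra_simps)
  also have "\<dots> = 1 - (2 + 2 * p\<^sup>2) / (r * (1 - p\<^sup>2)) + (1 / r)\<^sup>2"
    unfolding AR x2 using N by (simp add: A)
  also have "\<dots> = (r * (1 - p) - (1 + p)) * (r * (1 + p) - (1 - p)) / (r\<^sup>2 * (1 - p\<^sup>2))"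
    using r1 p2 by (simp add: field_simps) (simp add: power2_eq_square power4_eq_xxxx algebra_simps)
  also have "\<dots> > 0"
  proof -
    have "r * p \<ge> 0" using r1 p by simp
    moreover have "r * (1 + p) = r + r * p" by (simp add: algebra_simps)
    ultimately have "r * (1 + p) > 1 - p" using r1 p by linarith
    then show ?thesis using rp p2 r1 by simp
  qed
  finally show "admissible \<xi>0 (1 / (r * Re \<xi>0))"
    using A0 A1 by (simp add: admissible_def flip: A_def)
qed

text \<open>Up to a common factor, \<open>dir1\<close> and \<open>dir2\<close> are the components of the direction \<open>v\<close> after the
  automorphism of the symmetrized bidisc induced by \<open>x \<mapsto> (x - a) / (1 - cnj a * x)\<close> has moved the base
  point to \<open>(0, P)\<close>.\<close>

definition dir1 :: "complex \<Rightarrow> complex^2 \<Rightarrow> complex" where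
  "dir1 a v = (1 + a * cnj a) * v $ 1 - 2 * cnj a * v $ 2"

definition dir2 :: "complex \<Rightarrow> complex \<Rightarrow> complex^2 \<Rightarrow> complex" where
  "dir2 a P v = (1 - (cnj a)\<^sup>2 * P) * v $ 2 - (a - cnj a * P) * v $ 1"

text \<open>Cramer's rule for the linear system that defines \<open>dir1\<close> and
  \<open>dir2\<close>; the factor on the left is its determinant.\<close>

lemma dir_solve:
  "(1 - a * cnj a) * (1 + (cnj a)\<^sup>2 * P) * v $ 1 = (1 - (cnj a)\<^sup>2 * P) * dir1 a v + 2 * cnj a * dir2 a P v"
  "(1 - a * cnj a) * (1 + (cnj a)\<^sup>2 * P) * v $ 2 = (1 + a * cnj a) * dir2 a P v + (a - cnj a * P) * dir1 a v"
  by (simp_all add: dir1_def dir2_def power2_eq_square algebra_simps)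

text \<open>Rotation by \<open>\<kappa>\<close> puts the ellipse in standard position. The foot of a
  normal from \<open>q\<close> determines \<open>\<omega>\<close>, and \<open>r\<close> selects the
  disc of the pencil tangent to \<open>v\<close>.\<close>

lemma solutions_equivalent_generic:
  assumes a: "cmod a < 1" and P: "cmod P < 1"
    and l: "l = vector [2 * (a + cnj a * P) / (1 + (cnj a)\<^sup>2 * P), (P + a\<^sup>2) / (1 + (cnj a)\<^sup>2 * P)]"
    and \<kappa>: "cmod \<kappa> = 1" "\<kappa>\<^sup>2 * P = of_real (cmod P)"
    and v: "Im (\<kappa> * dir2 a P v * cnj (dir1 a v)) \<noteq> 0"
    and F: "solves_car l v F1" "solves_car l v F2"
  shows "\<exists>m. disc_automorphism m \<and> (\<forall>s\<in>symm_bidisc. F2 s = m (F1 s))"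
proof -
  define p where "p = cmod P"
  have p: "0 \<le> p" "p < 1" using P by (auto simp: p_def)
  have nz1: "dir1 a v \<noteq> 0" using v by auto
  define q where "q = 2 * \<kappa> * dir2 a P v / dir1 a v"
  have "Im q \<noteq> 0"
    using v by (simp add: q_def Im_complex_div_eq_0 mult.assoc)
  then obtain \<sigma> r where \<sigma>: "cmod \<sigma> = 1" and r: "r > (1 + p) / (1 - p)"
    and q: "q = (\<sigma> - cnj \<sigma> * p) - of_real r * (\<sigma> + cnj \<sigma> * p)"
    using ellipse_normal [OF p] by metis
  have "(1 + p) / (1 - p) > 0" using p by simp
  then have r0: "r > 0" using r by linarith
  define \<omega> where "\<omega> = cnj \<kappa> * \<sigma>"
  have \<omega>: "cmod \<omega> = 1" using \<sigma> \<kappa> by (simp add: \<omega>_def norm_mult)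
  have uni: "x * cnj x = 1" if "cmod x = 1" for x
    using complex_norm_square [of x] that by simp
  define P1 where "P1 = (cnj \<omega>)\<^sup>2 * P"
  have P1: "\<omega>\<^sup>2 * P1 = P"
    using uni [OF \<omega>] by (simp add: P1_def flip: power_mult_distrib mult.assoc)
  have P1n: "cmod P1 = p" using \<omega> by (simp add: P1_def norm_mult norm_power p_def)
  \<comment> \<open>The two disc points over \<open>(0, P)\<close> are opposite, so they correspond
    to reciprocal points of the half-plane. Hence the base point has second coordinate 1, and half
    the sum is \<open>\<xi>0\<close>.\<close>
  define \<xi>0 where "\<xi>0 = (1 - P1) / (1 + P1)"
  have nzP: "1 + P1 \<noteq> 0" using P1n p by (metis add_eq_0_iff less_irrefl norm_minus_cancel norm_one)
  have adm: "Re \<xi>0 > 0" "admissible \<xi>0 (1 / (r * Re \<xi>0))"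
    using admissible_base [of P1 r \<xi>0] P1n p r by (auto simp: \<xi>0_def)
  interpret half_plane_chart "a + \<omega>" "a - \<omega>" "1 + cnj a * \<omega>" "1 - cnj a * \<omega>"
    by (rule half_plane_chart_moebius [OF a \<omega>])
  \<comment> \<open>The slope \<open>2 * A * Re \<xi>0\<close> for
    \<open>A = 1 / (r * Re \<xi>0)\<close>.\<close>
  define t where "t = complex_of_real (2 / r)"
  have t: "t * r = 2" "t \<noteq> 0" using r0 by (auto simp: t_def)
  define \<rho> where "\<rho> = dir2 a P v / dir1 a v"
  \<comment> \<open>The equation of the normal through \<open>q\<close>, with the rotation by
    \<open>\<kappa>\<close> removed.\<close>
  have \<rho>: "t * \<rho> = \<omega> * (t * (1 - P1) / 2 - (1 + P1))"
  proof -
    have k\<sigma>: "\<kappa> * \<omega> = \<sigma>" using uni [OF \<kappa>(1)] by (simp add: \<omega>_def flip: mult.assoc)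
    have "\<omega> * P1 = (\<omega> * cnj \<omega>) * (cnj \<omega> * P)" by (simp add: P1_def power2_eq_square)
    then have oP: "\<omega> * P1 = cnj \<omega> * P" using uni [OF \<omega>] by simp
    have "\<kappa> * (cnj \<omega> * P) = cnj \<sigma> * (\<kappa>\<^sup>2 * P)" by (simp add: \<omega>_def power2_eq_square)
    then have kP: "\<kappa> * (\<omega> * P1) = cnj \<sigma> * p" unfolding oP \<kappa>(2) p_def .
    have "\<kappa> * (2 * (t * \<rho>)) = t * q" by (simp add: \<rho>_def q_def)
    also have "\<dots> = t * (\<sigma> - cnj \<sigma> * p) - 2 * (\<sigma> + cnj \<sigma> * p)"
      unfolding q using t(1) by (simp add: right_diff_distrib flip: mult.assoc)
    also have "\<dots> = \<kappa> * (2 * (\<omega> * (t * (1 - P1) / 2 - (1 + P1))))"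
      unfolding kP [symmetric] unfolding k\<sigma> [symmetric] by (simp add: algebra_simps)
    finally show ?thesis using \<kappa>(1) by auto
  qed
  define \<mu> where "\<mu> = 4 * t * (1 - a * cnj a) * (1 + (cnj a)\<^sup>2 * P) / ((1 + P1) * dir1 a v)"
  have den: "(1 + P1) * den \<xi>0 1 = 4 * (1 + (cnj a)\<^sup>2 * P)"
    using nzP unfolding den_def \<xi>0_def P1 [symmetric]
    by (simp add: field_simps) (simp add: power2_eq_square algebra_simps)
  have "chart \<xi>0 1 = l"
  proof -
    have 1: "(1 + P1) * (2 * (a + \<omega>) * (1 + cnj a * \<omega>) * 1 + 2 * ((a + \<omega>) * (1 - cnj a * \<omega>) + (a - \<omega>) * (1 + cnj a * \<omega>)) * \<xi>0
        + 2 * (a - \<omega>) * (1 - cnj a * \<omega>)) = 4 * (2 * (a + cnj a * P))"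
      using nzP unfolding \<xi>0_def P1 [symmetric]
      by (simp add: field_simps) (simp add: power2_eq_square algebra_simps)
    have 2: "(1 + P1) * ((a + \<omega>)\<^sup>2 * 1 + 2 * (a + \<omega>) * (a - \<omega>) * \<xi>0 + (a - \<omega>)\<^sup>2) = 4 * (P + a\<^sup>2)"
      using nzP unfolding \<xi>0_def P1 [symmetric]
      by (simp add: field_simps) (simp add: power2_eq_square algebra_simps)
    have *: "x / den \<xi>0 1 = ((1 + P1) * x) / (4 * (1 + (cnj a)\<^sup>2 * P))" for x
      unfolding den [symmetric] using nzP by simp
    have "(4 * x) / (4 * y) = x / y" for x y :: complex by simp
    then show ?thesis unfolding chart_def * 1 2 l by (simp only:)
  qed
  moreover have "tangent \<xi>0 (2 * (1 / (r * Re \<xi>0)) * Re \<xi>0) = \<mu> *s v"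
  proof -
    have t': "complex_of_real (2 * (1 / (r * Re \<xi>0)) * Re \<xi>0) = t"
      using adm(1) by (simp add: t_def)
    have \<mu>1: "\<mu> * v $ 1 = 4 * t * ((1 - (cnj a)\<^sup>2 * P) + 2 * cnj a * \<rho>) / (1 + P1)"
    proof -
      have "\<mu> * v $ 1 = 4 * t * ((1 - a * cnj a) * (1 + (cnj a)\<^sup>2 * P) * v $ 1) / ((1 + P1) * dir1 a v)"
        by (simp add: \<mu>_def)
      then show ?thesis
        unfolding dir_solve \<rho>_def using nz1 nzP by (simp add: field_simps)
    qed
    have \<mu>2: "\<mu> * v $ 2 = 4 * t * ((1 + a * cnj a) * \<rho> + (a - cnj a * P)) / (1 + P1)"
    proof -
      have "\<mu> * v $ 2 = 4 * t * ((1 - a * cnj a) * (1 + (cnj a)\<^sup>2 * P) * v $ 2) / ((1 + P1) * dir1 a v)"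
        by (simp add: \<mu>_def)
      then show ?thesis
        unfolding dir_solve \<rho>_def using nz1 nzP by (simp add: field_simps)
    qed
    have "(1 + P1) * (tangent \<xi>0 t $ 1) = 4 * (t * (1 - (cnj a)\<^sup>2 * P) + 2 * cnj a * (t * \<rho>))"
      using nzP unfolding \<rho> tangent_def \<xi>0_def P1 [symmetric]
      by (simp add: field_simps) (simp add: power2_eq_square algebra_simps)
    then have 1: "tangent \<xi>0 t $ 1 = \<mu> * v $ 1"
      unfolding \<mu>1 using nzP by (simp add: eq_divide_eq) (simp add: algebra_simps)
    have "(1 + P1) * (tangent \<xi>0 t $ 2) = 4 * ((1 + a * cnj a) * (t * \<rho>) + t * (a - cnj a * P))"
      using nzP unfolding \<rho> tangent_def \<xi>0_def P1 [symmetric]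
      by (simp add: field_simps) (simp add: power2_eq_square algebra_simps)
    then have 2: "tangent \<xi>0 t $ 2 = \<mu> * v $ 2"
      unfolding \<mu>2 using nzP by (simp add: eq_divide_eq) (simp add: algebra_simps)
    show ?thesis unfolding t' using 1 2 by (simp add: vec_eq_iff forall_2)
  qed
  ultimately show ?thesis
    using solutions_equivalent [OF adm] F by blast
qed

section \<open>Dense open sets of complex lines\<close>

text \<open>Homogeneity makes \<open>Q v \<noteq> 0\<close> a property of the line. If
  \<open>Q v = 0\<close>, then \<open>Q (v + y) + Q (v - y) = 2 * Q y\<close>, so for a small
  multiple \<open>y\<close> of \<open>x\<close> one of \<open>v + y\<close>, \<open>v - y\<close>
  leaves the zero set.\<close>

lemma open_dense_lines:
  fixes Q :: "complex^'n \<Rightarrow> real"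
  assumes cont: "continuous_on UNIV Q"
    and scale: "\<And>c v. Q (c *s v) = (cmod c)\<^sup>2 * Q v"
    and par: "\<And>u v. Q (u + v) + Q (u - v) = 2 * Q u + 2 * Q v"
    and x: "Q x \<noteq> 0"
  defines "V \<equiv> {vec.span {v} | v. Q v \<noteq> 0}"
  shows "openin proj_space V" "proj_space closure_of V = topspace proj_space"
    "v \<noteq> 0 \<Longrightarrow> vec.span {v} \<in> V \<longleftrightarrow> Q v \<noteq> 0"
proof -
  have Q0: "Q 0 = 0" using scale [of 0 0] by simp
  show mem: "vec.span {v} \<in> V \<longleftrightarrow> Q v \<noteq> 0" if "v \<noteq> 0" for v
  proof
    assume "vec.span {v} \<in> V"
    then obtain u where u: "Q u \<noteq> 0" "vec.span {v} = vec.span {u}" by (auto simp: V_def)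
    then have "u \<in> vec.span {v}" by (simp add: vec.span_base)
    then obtain k where "u = k *s v" by (auto simp: vec.span_singleton)
    then show "Q v \<noteq> 0" using u(1) by (simp add: scale)
  qed (auto simp: V_def)
  have "{v. v \<noteq> 0 \<and> vec.span {v} \<in> V} = {v. Q v \<noteq> 0}" using mem Q0 by (intro Collect_cong) metis
  moreover have "open {v. Q v \<noteq> 0}" using cont by (intro open_Collect_neq) auto
  moreover have "V \<subseteq> complex_lines"
    using Q0 by (auto simp: V_def complex_lines_eq)
  ultimately show "openin proj_space V" by (simp add: openin_proj_space)
  show "proj_space closure_of V = topspace proj_space"
  proof (intro equalityI closure_of_subset_topspace subsetI)
    fix L :: "(complex^'n) set" assume L: "L \<in> topspace proj_space"
    show "L \<in> proj_space closure_of V"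
      unfolding in_closure_of
    proof (intro conjI allI impI L)
      fix T assume T: "L \<in> T \<and> openin proj_space T"
      obtain v where v: "v \<noteq> 0" "L = vec.span {v}"
        using L by (auto simp: topspace_proj_space complex_lines_eq)
      define S where "S = {v. v \<noteq> 0 \<and> vec.span {v} \<in> T}"
      have "open S" "v \<in> S" using T v by (auto simp: S_def openin_proj_space)
      then obtain \<delta> where \<delta>: "\<delta> > 0" "ball v \<delta> \<subseteq> S" by (meson open_contains_ball)
      obtain u where "u \<in> S" "Q u \<noteq> 0"
      proof (cases "Q v = 0")
        case False
        then show ?thesis using that \<open>v \<in> S\<close> by blast
      next
        case True
        have x0: "x \<noteq> 0" using x Q0 by auto
        define \<epsilon> where "\<epsilon> = \<delta> / (2 * norm x)"
        define y where "y = complex_of_real \<epsilon> *s x"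
        have \<epsilon>: "\<epsilon> > 0" using \<delta> x0 by (simp add: \<epsilon>_def)
        have "y = \<epsilon> *\<^sub>R x" 
          unfolding vec_eq_iff y_def vector_scaleR_component vector_smult_component
          by (simp add: scaleR_conv_of_real)
        then have "norm y < \<delta>" using \<delta>(1) x0 by (simp add: \<epsilon>_def)
        then have "v + y \<in> S" "v - y \<in> S" using \<delta>(2) by (auto simp: dist_norm)
        moreover have "Q (v + y) + Q (v - y) \<noteq> 0"
          unfolding par True using \<epsilon> x by (simp add: y_def scale)
        then have "Q (v + y) \<noteq> 0 \<or> Q (v - y) \<noteq> 0" by auto
        ultimately show ?thesis using that by blast
      qed
      then show "\<exists>y. y \<in> V \<and> y \<in> T" by (auto simp: S_def V_def)
    qed
  qed
qed

theorem corollary2p7: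
  fixes l :: "complex^2"
  assumes "l \<in> symm_bidisc"
  shows "\<exists>V. openin proj_space V \<and> proj_space closure_of V = topspace proj_space \<and>
    (\<forall>v :: complex^2. v \<noteq> 0 \<and> vec.span {v} \<in> V \<longrightarrow>
      (\<forall>F1 F2. solves_car l v F1 \<and> solves_car l v F2 \<longrightarrow>
        (\<exists>m. disc_automorphism m \<and> (\<forall>s\<in>symm_bidisc. F2 s = m (F1 s)))))"
proof -
  obtain a P where a: "cmod a < 1" and P: "cmod P < 1" and E: "1 + (cnj a)\<^sup>2 * P \<noteq> 0"
    and l: "l = vector [2 * (a + cnj a * P) / (1 + (cnj a)\<^sup>2 * P), (P + a\<^sup>2) / (1 + (cnj a)\<^sup>2 * P)]"
    using symm_bidisc_midpoint [OF assms] .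
  define \<kappa> where "\<kappa> = cis (- Arg P / 2)"
  have \<kappa>: "cmod \<kappa> = 1" by (simp add: \<kappa>_def)
  have "\<kappa>\<^sup>2 * P = cis (- Arg P) * (cmod P * cis (Arg P))"
    using rcis_cmod_Arg [of P] by (simp add: \<kappa>_def Complex.DeMoivre rcis_def)
  then have \<kappa>P: "\<kappa>\<^sup>2 * P = of_real (cmod P)" by (simp add: cis_mult)
  \<comment> \<open>Nonvanishing says that \<open>dir1 a v \<noteq> 0\<close> and that
    \<open>\<kappa> * dir2 a P v / dir1 a v\<close> is not real, that is, off the line of the minor
    axis.\<close>
  define Q where "Q v = Im (\<kappa> * dir2 a P v * cnj (dir1 a v))" for v
  have lin: "dir1 a (u + v) = dir1 a u + dir1 a v" "dir1 a (u - v) = dir1 a u - dir1 a v"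
    "dir1 a (c *s v) = c * dir1 a v" "dir2 a P (u + v) = dir2 a P u + dir2 a P v"
    "dir2 a P (u - v) = dir2 a P u - dir2 a P v" "dir2 a P (c *s v) = c * dir2 a P v" for u v c
    by (simp_all add: dir1_def dir2_def algebra_simps)
  have cont: "continuous_on UNIV Q"
    unfolding Q_def [abs_def] dir1_def dir2_def by (intro continuous_intros)
  have scale: "Q (c *s v) = (cmod c)\<^sup>2 * Q v" for c v
  proof -
    have e: "\<kappa> * dir2 a P (c *s v) * cnj (dir1 a (c *s v)) = (c * cnj c) * (\<kappa> * dir2 a P v * cnj (dir1 a v))"
      by (simp add: lin)
    show ?thesis
      unfolding Q_def e complex_norm_square [symmetric] by (simp del: of_real_power)
  qed
  have par: "Q (u + v) + Q (u - v) = 2 * Q u + 2 * Q v" for u v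
    by (simp add: Q_def lin algebra_simps)
  define \<Delta> where "\<Delta> = (1 - a * cnj a) * (1 + (cnj a)\<^sup>2 * P)"
  have "complex_of_real (1 - (cmod a)\<^sup>2) \<noteq> 0"
    using a by (metis abs_norm_cancel abs_square_less_1 less_irrefl of_real_eq_0_iff diff_gt_0_iff_gt)
  then have \<Delta>: "\<Delta> \<noteq> 0" using E unfolding \<Delta>_def of_real_diff of_real_1 complex_norm_square by simp
  \<comment> \<open>The right-hand sides of \<open>dir_solve\<close> for the values 1 and
    \<open>\<i> * cnj \<kappa>\<close> of \<open>dir1\<close> and \<open>dir2\<close>, which make
    the quantity in \<open>Q\<close> purely imaginary.\<close>
  define x :: "complex^2" where "x = vector [(1 - (cnj a)\<^sup>2 * P) + 2 * cnj a * (\<i> * cnj \<kappa>),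
    (1 + a * cnj a) * (\<i> * cnj \<kappa>) + (a - cnj a * P)]"
  have "dir1 a x = \<Delta>" "dir2 a P x = \<i> * cnj \<kappa> * \<Delta>"
    by (simp_all add: x_def dir1_def dir2_def \<Delta>_def power2_eq_square algebra_simps)
  then have "\<kappa> * dir2 a P x * cnj (dir1 a x) = \<i> * (\<kappa> * cnj \<kappa>) * (\<Delta> * cnj \<Delta>)" by simp
  also have "\<dots> = \<i> * of_real ((cmod \<Delta>)\<^sup>2)"
    unfolding complex_norm_square [symmetric] using \<kappa> by simp
  finally have "Q x = (cmod \<Delta>)\<^sup>2" unfolding Q_def by (simp del: of_real_power)
  then have "Q x \<noteq> 0" using \<Delta> by simp
  note V = open_dense_lines [of Q, OF cont scale par this]
  show ?thesis
  proof (intro exI [of _ "{vec.span {v} | v. Q v \<noteq> 0}"] conjI allI impI)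
    show "openin proj_space {vec.span {v} | v. Q v \<noteq> 0}" by (rule V)
    show "proj_space closure_of {vec.span {v} | v. Q v \<noteq> 0} = topspace proj_space" by (rule V)
    fix v F1 F2
    assume v: "v \<noteq> 0 \<and> vec.span {v} \<in> {vec.span {v} | v. Q v \<noteq> 0}" and F: "solves_car l v F1 \<and> solves_car l v F2"
    have "Q v \<noteq> 0" using V(3) [of v] v by blast
    then show "\<exists>m. disc_automorphism m \<and> (\<forall>s\<in>symm_bidisc. F2 s = m (F1 s))"
      using solutions_equivalent_generic [OF a P l \<kappa> \<kappa>P] F by (simp add: Q_def)
  qed
qed

end
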